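(* Let $G \subset \mathbb{Q}/\mathbb{Z}$ be a finite group, let $P \subseteq G$, let $f \in G\setminus\{0\}$, and let $\pi\colon P \to \mathbb{R}_+$ be a facet of the finite group problem $R_f(P)$. Then there exists a facet $\phi\colon \mathbb{R}/\mathbb{Z}\to\mathbb{R}_+$ of the infinite group problem $R_f(\mathbb{R}/\mathbb{Z})$ such that $\phi|_P = \pi$. Moreover, $\phi$ can be chosen to be a continuous piecewise linear two-slope function with rational breakpoints.
   Context: For a subset $P\subseteq \mathbb{R}/\mathbb{Z}$ and $f\in(\mathbb{R}/\mathbb{Z})\setminus\{0\}$, a solution is a finite-support function $y\colon P\to\mathbb{Z}_+$ (nonnegative integers) with $\sum_{p\in P} y(p)\,p = f$ in $\mathbb{R}/\mathbb{Z}$. $R_f(P)$ is the convex hull of all solutions. A function $\pi\colon P\to\mathbb{R}_+$ is a valid function for $R_f(P)$ if $\sum_{p\in P}\pi(p)y(p)\ge 1$ for every solution $y$. A valid function $\pi$ is minimal if there is no valid function $\pi^\dagger\ne\pi$ with $\pi^\dagger\le\pi$ pointwise. A minimal valid function $\pi$ is extreme if, whenever $\pi=\frac12(\pi^++\pi^-)$ with $\pi^+,\pi^-$ minimal valid functions, then $\pi=\pi^+=\pi^-$. For finite $P$, a facet of $R_f(P)$ is a valid function $\pi$ such that the inequality $\sum_{p\in P}\pi(p)y(p)\ge 1$ is facet-defining for the polyhedron $R_f(P)\subseteq\mathbb{R}^P_+$ (equivalently, $\pi$ is extreme among the minimal valid functions). For the infinite group problem $R_f(\mathbb{R}/\mathbb{Z})$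 and continuous piecewise linear functions, "facet" is used interchangeably with "extreme function". Functions on $\mathbb{R}/\mathbb{Z}$ are identified with $\mathbb{Z}$-periodic functions on $\mathbb{R}$; piecewise linear means affine on each of finitely many intervals (per period) whose endpoints are the breakpoints; two-slope means that the derivative, where it exists, takes exactly two distinct values. *)

theory Defs
  imports "HOL-Analysis.Analysis" "HOL-Analysis.Finite_Function_Topology"
begin

section \<open>The group of reals modulo integers\<close>

quotient_type circle = real / "\<lambda>x y. x - y \<in> \<int>"
  morphisms rep_circle circle_of
proof (rule equivpI)
  show "reflp (\<lambda>x y :: real. x - y \<in> \<int>)"
    by (simp add: reflp_def)
  show "symp (\<lambda>x y :: real. x - y \<in> \<int>)"
    by (auto simp: symp_def) (metis Ints_minus minus_diff_eq)
  show "transp (\<lambda>x y :: real. x - y \<in> \<int>)"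
    by (auto simp: transp_def) (metis Ints_add diff_add_cancel add_diff_eq)
qed

instantiation circle :: ab_group_add
begin

lift_definition zero_circle :: circle is 0 .

lift_definition plus_circle :: "circle \<Rightarrow> circle \<Rightarrow> circle" is "(+)"
  by (metis Ints_add add_diff_add)

lift_definition minus_circle :: "circle \<Rightarrow> circle \<Rightarrow> circle" is "(-)"
proof -
  fix a b c d :: real
  assume "a - b \<in> \<int>" "c - d \<in> \<int>"
  then have "(a - b) - (c - d) \<in> \<int>" by (rule Ints_diff)
  then show "a - c - (b - d) \<in> \<int>" by (simp add: algebra_simps)
qed

lift_definition uminus_circle :: "circle \<Rightarrow> circle" is uminus
proof -
  fix a b :: real
  assume "a - b \<in> \<int>"
  then have "- (a - b) \<in> \<int>" by (simp only: Ints_minus)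
  then show "- a - - b \<in> \<int>" by simp
qed

instance
  by standard (transfer; simp add: algebra_simps)+

end

definition rational_circle :: "circle set" where
  "rational_circle = circle_of ` \<rat>"

definition subgroup_circle :: "circle set \<Rightarrow> bool" where
  "subgroup_circle G \<longleftrightarrow> 0 \<in> G \<and> (\<forall>x\<in>G. \<forall>y\<in>G. x - y \<in> G)"


section \<open>Solutions, valid, minimal and extreme functions\<close>

text \<open>A function on \<open>P\<close> is represented by a total function of which only the values on \<open>P\<close>
  matter. The inner sum is the multiple of \<open>p\<close> by the natural number \<open>y(p)\<close>.\<close>

definition solutions :: "circle set \<Rightarrow> circle \<Rightarrow> (circle \<Rightarrow>\<^sub>0 nat) set" where
  "solutions P f = {y. Poly_Mapping.keys y \<subseteq> P \<and>
     (\<Sum>p\<in>Poly_Mapping.keys y. \<Sum>i<Poly_Mapping.lookup y p. p) = f}"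

definition valid_function :: "circle set \<Rightarrow> circle \<Rightarrow> (circle \<Rightarrow> real) \<Rightarrow> bool" where
  "valid_function P f \<pi> \<longleftrightarrow> (\<forall>p\<in>P. 0 \<le> \<pi> p) \<and>
     (\<forall>y\<in>solutions P f.
        1 \<le> (\<Sum>p\<in>Poly_Mapping.keys y. \<pi> p * real (Poly_Mapping.lookup y p)))"

definition minimal_valid_function :: "circle set \<Rightarrow> circle \<Rightarrow> (circle \<Rightarrow> real) \<Rightarrow> bool" where
  "minimal_valid_function P f \<pi> \<longleftrightarrow> valid_function P f \<pi> \<and>
     \<not> (\<exists>\<pi>'. valid_function P f \<pi>' \<and> (\<forall>p\<in>P. \<pi>' p \<le> \<pi> p) \<and> (\<exists>p\<in>P. \<pi>' p \<noteq> \<pi> p))"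

definition extreme_function :: "circle set \<Rightarrow> circle \<Rightarrow> (circle \<Rightarrow> real) \<Rightarrow> bool" where
  "extreme_function P f \<pi> \<longleftrightarrow> minimal_valid_function P f \<pi> \<and>
     (\<forall>\<pi>1 \<pi>2. minimal_valid_function P f \<pi>1 \<and> minimal_valid_function P f \<pi>2 \<and>
        (\<forall>p\<in>P. \<pi> p = (\<pi>1 p + \<pi>2 p) / 2) \<longrightarrow>
        (\<forall>p\<in>P. \<pi> p = \<pi>1 p \<and> \<pi> p = \<pi>2 p))"


section \<open>Facets of the finite group problem\<close>

text \<open>The library's \<^const>\<open>aff_dim\<close> and \<^const>\<open>facet_of\<close> are restricted to Euclidean spaces.
  The space of finitely supported functions is not one, so the two notions are restated
  for arbitrary real vector spaces.\<close>

definition has_aff_dim :: "'a::real_vector set \<Rightarrow> int \<Rightarrow> bool" where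
  "has_aff_dim S d \<longleftrightarrow> (\<exists>B. finite B \<and> affine hull B = affine hull S \<and>
     \<not> affine_dependent B \<and> int (card B) = d + 1)"

definition is_facet :: "'a::real_vector set \<Rightarrow> 'a set \<Rightarrow> bool" where
  "is_facet F S \<longleftrightarrow> F face_of S \<and> F \<noteq> {} \<and> (\<exists>d. has_aff_dim S d \<and> has_aff_dim F (d - 1))"

lemma has_aff_dim_euclidean:
  fixes S :: "'a::euclidean_space set"
  shows "has_aff_dim S d \<longleftrightarrow> aff_dim S = d"
proof
  assume "has_aff_dim S d"
  then show "aff_dim S = d"
    unfolding has_aff_dim_def using aff_dim_unique[of _ S] by auto
next
  assume "aff_dim S = d"
  then show "has_aff_dim S d"
    unfolding has_aff_dim_def
    using aff_dim_basis_exists[of S] aff_independent_finite by auto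
qed

lemma is_facet_euclidean:
  fixes S :: "'a::euclidean_space set"
  shows "is_facet F S \<longleftrightarrow> F facet_of S"
  by (auto simp: is_facet_def facet_of_def has_aff_dim_euclidean)

text \<open>For finite \<open>P\<close>, the space of real functions on \<open>P\<close> is embedded in the finitely supported
  real functions on the circle, as those vanishing outside \<open>P\<close>.\<close>

definition R_hull :: "circle set \<Rightarrow> circle \<Rightarrow> (circle \<Rightarrow>\<^sub>0 real) set" where
  "R_hull P f = convex hull (Poly_Mapping.map real ` solutions P f)"

definition facet_function :: "circle set \<Rightarrow> circle \<Rightarrow> (circle \<Rightarrow> real) \<Rightarrow> bool" where
  "facet_function P f \<pi> \<longleftrightarrow> valid_function P f \<pi> \<and>
     is_facet {y \<in> R_hull P f.
       (\<Sum>p\<in>Poly_Mapping.keys y. \<pi> p * Poly_Mapping.lookup y p) = 1} (R_hull P f)"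


section \<open>Piecewise linear functions on the circle\<close>

text \<open>\<open>B\<close> is a finite set that contains all breakpoints: the function is affine on every open
  interval of the real line that contains no representative of a point of \<open>B\<close>.\<close>

definition piecewise_linear_breakpoints :: "circle set \<Rightarrow> (circle \<Rightarrow> real) \<Rightarrow> bool" where
  "piecewise_linear_breakpoints B \<phi> \<longleftrightarrow> finite B \<and>
     (\<forall>a b. a < b \<and> (\<forall>x\<in>{a<..<b}. circle_of x \<notin> B) \<longrightarrow>
        (\<exists>m c. \<forall>x\<in>{a<..<b}. \<phi> (circle_of x) = m * x + c))"

definition two_slope :: "(circle \<Rightarrow> real) \<Rightarrow> bool" where
  "two_slope \<phi> \<longleftrightarrow>
     card {s. \<exists>x. ((\<lambda>t. \<phi> (circle_of t)) has_real_derivative s) (at x)} = 2"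

definition continuous_circle :: "(circle \<Rightarrow> real) \<Rightarrow> bool" where
  "continuous_circle \<phi> \<longleftrightarrow> continuous_on UNIV (\<lambda>t. \<phi> (circle_of t))"

end

theory Submission
  imports Defs
begin

text \<open>The tight solutions of a facet \<open>\<pi>\<close> span \<open>\<real>\<^sup>P\<close>. Hence \<open>\<pi>\<close> is rational and every \<open>p \<in> P\<close> occurs in
  a tight solution. Giving weight \<open>\<pi> p\<close> to \<open>p \<in> P\<close> and weight 1 to the other elements of \<open>G\<close>, let
  \<open>\<rho> a\<close> be the least weight of a representation of \<open>a\<close> as a sum of elements of \<open>G\<close>. Then \<open>\<rho>\<close> is
  subadditive, \<open>\<rho> f = 1\<close>, and tightness gives \<open>\<rho> p = \<pi> p\<close> and \<open>\<rho> (f - p) = 1 - \<pi> p\<close> on \<open>P\<close>.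

  For a large slope \<open>S\<close> put \<open>A x = min\<^sub>a (\<rho> a + S \<bar>x - a\<bar>)\<close> and let \<open>\<zeta>\<close> be a small odd \<open>G\<close>-periodic triangle
  wave with slopes \<open>\<plusminus>S\<close>. The function \<open>\<phi>\<close> is the median of \<open>1 - A (f - x)\<close>, \<open>1/2 + \<zeta> x\<close> and \<open>A x\<close>. It
  satisfies \<open>\<phi> x + \<phi> (f - x) = 1\<close>, so its subadditivity amounts to \<open>\<phi> x + \<phi> y + \<phi> t \<ge> 1\<close> for
  \<open>x + y + t = f\<close>. If two of the values are given by \<open>A\<close>, this follows from
  \<open>\<phi> t \<ge> 1 - A (x + y)\<close>; if two of them are at least \<open>1/2 + \<zeta>\<close>, it follows from the Lipschitz bound for \<open>\<zeta>\<close>.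
  All pieces have slopes \<open>\<plusminus>S\<close> on a common rational grid, and a minimal function with this property is extreme
  by the argument of Gomory and Johnson's two-slope theorem.\<close>

section \<open>Minimal valid functions of the infinite group problem\<close>

text \<open>Solutions are recast as finite multisets, where adding, removing or splitting a summand
  and induction are simpler than for multiplicity functions.\<close>

definition mset_of_pm :: "('a \<Rightarrow>\<^sub>0 nat) \<Rightarrow> 'a multiset" where
  "mset_of_pm y = (\<Sum>p\<in>Poly_Mapping.keys y. replicate_mset (Poly_Mapping.lookup y p) p)"

lemma sum_mset_image_sum_replicate:
  fixes g :: "'a \<Rightarrow> 'b::comm_monoid_add"
  assumes "finite A"
  shows "(\<Sum>x\<in>#(\<Sum>p\<in>A. replicate_mset (c p) p). g x) = (\<Sum>p\<in>A. \<Sum>i<c p. g p)"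
proof -
  have "(\<Sum>x\<in>#replicate_mset n p. g x) = (\<Sum>i<n. g p)" for n p
    by (induction n) (simp_all add: add.commute)
  with assms show ?thesis
    by (induction A rule: finite_induct) simp_all
qed

lemma sum_mset_of_pm:
  "(\<Sum>x\<in>#mset_of_pm y. g x) =
     (\<Sum>p\<in>Poly_Mapping.keys y. g p * real (Poly_Mapping.lookup y p))"
  by (simp add: mset_of_pm_def sum_mset_image_sum_replicate mult.commute)

lemma count_mset_of_pm: "count (mset_of_pm y) p = Poly_Mapping.lookup y p"
proof -
  have "count (mset_of_pm y) p =
      (\<Sum>q\<in>Poly_Mapping.keys y. if q = p then Poly_Mapping.lookup y q else 0)"
    by (simp add: mset_of_pm_def count_sum)
  also have "\<dots> = Poly_Mapping.lookup y p"
    by (simp add: sum.delta in_keys_iff)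
  finally show ?thesis .
qed

lemma set_mset_of_pm: "set_mset (mset_of_pm y) = Poly_Mapping.keys y"
  by (auto simp: set_mset_def count_mset_of_pm in_keys_iff)

lemma mset_of_pm_surj: "\<exists>y. mset_of_pm y = M"
proof -
  have "{x. count M x \<noteq> 0} = set_mset M"
    by (auto simp: not_in_iff)
  then have "Poly_Mapping.lookup (Abs_poly_mapping (count M)) = count M"
    by (intro Abs_poly_mapping_inverse) simp
  then show ?thesis
    by (intro exI[of _ "Abs_poly_mapping (count M)"] multiset_eqI) (simp add: count_mset_of_pm)
qed

lemma solutions_iff_mset:
  "y \<in> solutions P f \<longleftrightarrow> set_mset (mset_of_pm y) \<subseteq> P \<and> \<Sum>\<^sub># (mset_of_pm y) = f"
proof -
  have "(\<Sum>x\<in>#mset_of_pm y. x) = (\<Sum>p\<in>Poly_Mapping.keys y. \<Sum>i<Poly_Mapping.lookup y p. p)"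
    unfolding mset_of_pm_def by (rule sum_mset_image_sum_replicate) (rule finite_keys)
  then show ?thesis
    unfolding solutions_def set_mset_of_pm by simp
qed

lemma valid_function_iff_mset:
  "valid_function P f \<pi> \<longleftrightarrow> (\<forall>p\<in>P. 0 \<le> \<pi> p) \<and>
     (\<forall>M. set_mset M \<subseteq> P \<and> \<Sum>\<^sub># M = f \<longrightarrow> 1 \<le> (\<Sum>x\<in>#M. \<pi> x))"
proof -
  have "(\<forall>M. Q M) \<longleftrightarrow> (\<forall>y. Q (mset_of_pm y))" for Q :: "circle multiset \<Rightarrow> bool"
    by (rule iffI, blast, rule allI) (metis (full_types) mset_of_pm_surj)
  then show ?thesis
    unfolding valid_function_def Ball_def solutions_iff_mset by (simp add: sum_mset_of_pm)
qed

lemma valid_functionD: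
  assumes "valid_function UNIV f \<pi>"
  shows "0 \<le> \<pi> x" "\<Sum>\<^sub># M = f \<Longrightarrow> 1 \<le> (\<Sum>x\<in>#M. \<pi> x)"
  using assms by (auto simp: valid_function_iff_mset)

text \<open>Lowering the value at \<open>a + b\<close> to \<open>\<pi> a + \<pi> b\<close> keeps validity, because every copy of \<open>a + b\<close>
  in a solution can be replaced by the pair \<open>a\<close>, \<open>b\<close>.\<close>

lemma minimal_imp_subadditive:
  assumes min: "minimal_valid_function UNIV f \<pi>"
  shows "\<pi> (a + b) \<le> \<pi> a + \<pi> b"
proof (rule ccontr)
  assume less: "\<not> ?thesis"
  have valid: "valid_function UNIV f \<pi>"
    using min by (simp add: minimal_valid_function_def)
  note nonneg = valid_functionD(1)[OF valid]
  have ne: "a + b \<noteq> a" "a + b \<noteq> b"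
    using less nonneg[of a] nonneg[of b] by auto
  define \<pi>' where "\<pi>' = \<pi>(a + b := \<pi> a + \<pi> b)"
  define split where "split x = (if x = a + b then {#a, b#} else {#x#})" for x
  have split: "(\<Sum>x\<in>#split x. \<pi> x) = \<pi>' x" "\<Sum>\<^sub># (split x) = x" for x
    using ne by (auto simp: split_def \<pi>'_def)
  have "(\<Sum>x\<in>#M. \<pi>' x) \<ge> 1" if "\<Sum>\<^sub># M = f" for M
  proof -
    have "\<Sum>\<^sub># (\<Sum>x\<in>#M. split x) = \<Sum>\<^sub># M"
      by (induction M) (simp_all add: split)
    moreover have "(\<Sum>x\<in>#(\<Sum>x\<in>#M. split x). \<pi> x) = (\<Sum>x\<in>#M. \<pi>' x)"
      by (induction M) (simp_all add: split)
    ultimately show ?thesis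
      using valid_functionD(2)[OF valid, of "\<Sum>x\<in>#M. split x"] that by simp
  qed
  then have "valid_function UNIV f \<pi>'"
    using nonneg by (auto simp: valid_function_iff_mset \<pi>'_def)
  moreover have "\<pi>' x \<le> \<pi> x" for x
    using less by (simp add: \<pi>'_def)
  moreover have "\<pi>' (a + b) \<noteq> \<pi> (a + b)"
    using less by (simp add: \<pi>'_def)
  ultimately show False
    using min unfolding minimal_valid_function_def by blast
qed

text \<open>One half of the Gomory-Johnson characterization of minimality. Subadditivity and
  \<open>\<phi> f = 1\<close> give validity; by symmetry the solution \<open>{#x, f - x#}\<close> is
  tight, so the value at \<open>x\<close> cannot be lowered.\<close>

lemma minimal_valid_functionI:
  assumes nonneg: "\<And>x. 0 \<le> \<phi> x" and zero: "\<phi> 0 = 0"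
    and subadd: "\<And>x y. \<phi> (x + y) \<le> \<phi> x + \<phi> y"
    and symm: "\<And>x. \<phi> x + \<phi> (f - x) = 1"
  shows "minimal_valid_function UNIV f \<phi>"
proof -
  have sum_le: "\<phi> (\<Sum>\<^sub># M) \<le> (\<Sum>x\<in>#M. \<phi> x)" for M
    by (induction M) (auto simp: zero intro: order_trans[OF subadd])
  have "\<phi> f = 1"
    using symm[of 0] zero by simp
  then have "1 \<le> (\<Sum>x\<in>#M. \<phi> x)" if "\<Sum>\<^sub># M = f" for M
    using sum_le[of M] that by simp
  then have "valid_function UNIV f \<phi>"
    using nonneg by (simp add: valid_function_iff_mset)
  moreover have "\<phi>' x = \<phi> x" if "valid_function UNIV f \<phi>'" and le: "\<And>x. \<phi>' x \<le> \<phi> x" for \<phi>' x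
    using valid_functionD(2)[OF that(1), of "{#x, f - x#}"] symm[of x] le[of x] le[of "f - x"] by simp
  ultimately show ?thesis
    unfolding minimal_valid_function_def by blast
qed

section \<open>Facets of the finite group problem\<close>

text \<open>The hull is full-dimensional because elements of \<open>P\<close> are torsion. A facet
  therefore has \<open>card P\<close> affinely independent points; they lie on the hyperplane
  \<open>ev \<pi> y = 1\<close>, which misses 0, so they are a basis of the space of functions on
  \<open>P\<close>. The tight equations thus have only one solution.\<close>

lemma facet_function_unique:
  assumes fin: "finite P" and tors: "\<And>p. p \<in> P \<Longrightarrow> \<exists>m>0::nat. (\<Sum>i<m. p) = (0::circle)"
    and facet: "facet_function P f \<pi>"
    and tight: "\<And>y. y \<in> solutions P f \<Longrightarrow>
      (\<Sum>p\<in>Poly_Mapping.keys y. \<pi> p * real (Poly_Mapping.lookup y p)) = 1 \<Longrightarrow>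
      (\<Sum>p\<in>Poly_Mapping.keys y. \<theta> p * real (Poly_Mapping.lookup y p)) = 1"
    and p: "p \<in> P"
  shows "\<theta> p = \<pi> p"
proof -
  define V where "V = Poly_Mapping.map real ` solutions P f"
  \<comment> \<open>Summing over the fixed set \<open>P\<close> instead of over the keys makes
    \<open>ev w\<close> linear; both sums agree on \<open>W\<close>.\<close>
  define ev :: "(circle \<Rightarrow> real) \<Rightarrow> (circle \<Rightarrow>\<^sub>0 real) \<Rightarrow> real"
    where "ev w y = (\<Sum>p\<in>P. w p * Poly_Mapping.lookup y p)" for w y
  define e :: "circle \<Rightarrow> (circle \<Rightarrow>\<^sub>0 real)" where "e q = Poly_Mapping.single q 1" for q
  define W where "W = span (e ` P)"
  define F where "F = {y \<in> R_hull P f. (\<Sum>p\<in>Poly_Mapping.keys y. \<pi> p * Poly_Mapping.lookup y p) = 1}"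

  have lookup_scaleR: "Poly_Mapping.lookup (c *\<^sub>R y) q = c * Poly_Mapping.lookup y q"
    for c q and y :: "circle \<Rightarrow>\<^sub>0 real"
    by (simp add: scaleR_poly_mapping_def Poly_Mapping.map.rep_eq when_def)
  have lookup_real: "Poly_Mapping.lookup (Poly_Mapping.map real y) q = real (Poly_Mapping.lookup y q)" for y q
    by (simp add: Poly_Mapping.map.rep_eq when_def)
  have ev_linear: "linear (ev w)" for w
    by (rule linearI) (simp_all add: ev_def lookup_add lookup_scaleR sum.distrib ring_distribs
        sum_distrib_left mult_ac)
  have ev_e: "ev w (e q) = w q" if "q \<in> P" for w q
  proof -
    have "ev w (e q) = (\<Sum>p\<in>P. if p = q then w q else 0)"
      unfolding ev_def e_def by (intro sum.cong) (auto simp: lookup_single when_def)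
    then show ?thesis
      using fin that by simp
  qed
  have in_W: "y \<in> W" if "Poly_Mapping.keys y \<subseteq> P" for y
  proof -
    have "y = (\<Sum>q\<in>P. Poly_Mapping.lookup y q *\<^sub>R e q)"
    proof (rule poly_mapping_eqI)
      fix r
      have "Poly_Mapping.lookup (\<Sum>q\<in>P. Poly_Mapping.lookup y q *\<^sub>R e q) r
          = (\<Sum>q\<in>P. if q = r then Poly_Mapping.lookup y r else 0)"
        unfolding lookup_sum lookup_scaleR e_def
        by (intro sum.cong) (auto simp: lookup_single when_def)
      then show "Poly_Mapping.lookup y r = Poly_Mapping.lookup (\<Sum>q\<in>P. Poly_Mapping.lookup y q *\<^sub>R e q) r"
        using fin that by (auto simp: in_keys_iff)
    qed
    also have "\<dots> \<in> W"
      unfolding W_def by (intro span_sum span_scale span_base) auto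
    finally show ?thesis .
  qed
  have keys_W: "Poly_Mapping.keys y \<subseteq> P" if "y \<in> W" for y
  proof -
    have "subspace {y :: circle \<Rightarrow>\<^sub>0 real. Poly_Mapping.keys y \<subseteq> P}"
      unfolding subspace_def by (auto simp: in_keys_iff lookup_add lookup_scaleR) (metis add_0 subsetD in_keys_iff)
    then have "W \<subseteq> {y. Poly_Mapping.keys y \<subseteq> P}"
      unfolding W_def by (intro span_minimal) (auto simp: e_def split: if_splits)
    then show ?thesis
      using that by auto
  qed
  have ev_keys: "(\<Sum>p\<in>Poly_Mapping.keys y. w p * Poly_Mapping.lookup y p) = ev w y" if "y \<in> W" for w y
    unfolding ev_def using fin keys_W[OF that]
    by (intro sum.mono_neutral_left) (auto simp: in_keys_iff)
  have V_W: "V \<subseteq> W"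
    by (auto simp: V_def solutions_def intro!: in_W) (auto simp: in_keys_iff lookup_real)
  have ev_real: "ev w (Poly_Mapping.map real y) =
      (\<Sum>p\<in>Poly_Mapping.keys y. w p * real (Poly_Mapping.lookup y p))" if "y \<in> solutions P f" for w y
  proof -
    have "Poly_Mapping.keys (Poly_Mapping.map real y) = Poly_Mapping.keys y"
      by (auto simp: in_keys_iff lookup_real)
    then show ?thesis
      using ev_keys[of "Poly_Mapping.map real y" w] V_W that by (auto simp: V_def lookup_real)
  qed
  have hull: "R_hull P f = convex hull V"
    by (simp add: R_hull_def V_def)
  have hull_W: "convex hull V \<subseteq> W"
    using V_W by (intro hull_minimal) (auto simp: W_def subspace_imp_convex)
  have F_eq: "F = {y \<in> convex hull V. ev \<pi> y = 1}"
    using hull_W by (auto simp: F_def hull ev_keys)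

  \<comment> \<open>This set carries the hypothesis from tight solutions to all of \<open>F\<close>:
    a convex combination of points with \<open>ev \<pi>\<close> at least 1 attains 1 only if every
    point of positive weight does.\<close>
  have "convex {y. 1 \<le> ev \<pi> y \<and> (ev \<pi> y = 1 \<longrightarrow> ev \<theta> y = 1)}"
  proof (rule convexI)
    fix x y and u v :: real
    assume xy: "x \<in> {y. 1 \<le> ev \<pi> y \<and> (ev \<pi> y = 1 \<longrightarrow> ev \<theta> y = 1)}"
      "y \<in> {y. 1 \<le> ev \<pi> y \<and> (ev \<pi> y = 1 \<longrightarrow> ev \<theta> y = 1)}" and uv: "0 \<le> u" "0 \<le> v" "u + v = 1"
    have ev_comb: "ev w (u *\<^sub>R x + v *\<^sub>R y) = u * ev w x + v * ev w y" for w
      using ev_linear[of w] by (simp add: linear_add linear_scale)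
    have ge: "u * 1 \<le> u * ev \<pi> x" "v * 1 \<le> v * ev \<pi> y"
      using xy uv by (simp_all del: mult_1_right mult.right_neutral add: mult_left_mono)
    have "ev \<theta> (u *\<^sub>R x + v *\<^sub>R y) = 1" if "ev \<pi> (u *\<^sub>R x + v *\<^sub>R y) = 1"
    proof -
      have "u * ev \<pi> x = u" "v * ev \<pi> y = v"
        using that ge uv unfolding ev_comb by linarith+
      then have "u * ev \<theta> x = u" "v * ev \<theta> y = v"
        using xy by auto
      then show ?thesis
        using uv unfolding ev_comb by linarith
    qed
    then show "u *\<^sub>R x + v *\<^sub>R y \<in> {y. 1 \<le> ev \<pi> y \<and> (ev \<pi> y = 1 \<longrightarrow> ev \<theta> y = 1)}"
      using ge uv by (simp add: ev_comb)
  qed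
  moreover have "V \<subseteq> {y. 1 \<le> ev \<pi> y \<and> (ev \<pi> y = 1 \<longrightarrow> ev \<theta> y = 1)}"
    using facet tight by (auto simp: V_def ev_real facet_function_def valid_function_def)
  ultimately have "convex hull V \<subseteq> {y. 1 \<le> ev \<pi> y \<and> (ev \<pi> y = 1 \<longrightarrow> ev \<theta> y = 1)}"
    by (intro hull_minimal)
  then have F_sub: "F \<subseteq> {y. ev \<pi> y = 1 \<and> ev \<theta> y = 1}"
    by (auto simp: F_eq)
  moreover have "affine {y. ev \<pi> y = 1 \<and> ev \<theta> y = 1}"
    using ev_linear by (auto simp: affine_def linear_add linear_scale simp flip: distrib_right)
  ultimately have aff_F: "affine hull F \<subseteq> {y. ev \<pi> y = 1 \<and> ev \<theta> y = 1}"
    by (intro hull_minimal)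

  obtain d where "has_aff_dim (convex hull V) d" "has_aff_dim F (d - 1)" and "F \<noteq> {}"
    using facet unfolding facet_function_def is_facet_def F_def hull by auto
  then obtain B C where B: "finite B" "affine hull B = affine hull (convex hull V)" "int (card B) = d + 1"
    and C: "finite C" "affine hull C = affine hull F" "\<not> affine_dependent C" "int (card C) = d"
    unfolding has_aff_dim_def by auto

  have indep_e: "independent (e ` P)" and card_e: "card (e ` P) = card P"
  proof -
    have inj: "inj_on e P"
    proof (rule inj_onI)
      fix q r assume "q \<in> P" "r \<in> P" "e q = e r"
      then show "q = r"
        using ev_e[of q "\<lambda>s. if s = r then 1 else 0"] ev_e[of r "\<lambda>s. if s = r then 1 else 0"]
        by (simp split: if_splits)
    qed
    then show "card (e ` P) = card P"
      by (rule card_image)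
    show "independent (e ` P)"
    proof (rule independent_if_scalars_zero)
      fix h x assume sum0: "(\<Sum>x\<in>e ` P. h x *\<^sub>R x) = 0" and "x \<in> e ` P"
      then obtain q where q: "q \<in> P" "x = e q" by auto
      have "0 = Poly_Mapping.lookup (\<Sum>r\<in>P. h (e r) *\<^sub>R e r) q"
        using sum0 inj by (simp add: sum.reindex)
      also have "\<dots> = (\<Sum>r\<in>P. if r = q then h (e q) else 0)"
        unfolding lookup_sum lookup_scaleR e_def
        by (intro sum.cong) (auto simp: lookup_single when_def)
      finally show "h x = 0"
        using fin q by simp
    qed (use fin in simp)
  qed

  \<comment> \<open>Full dimension: the direction space \<open>L\<close> of the affine hull
    \<open>T\<close> contains every \<open>e q\<close>, hence \<open>W\<close>; so \<open>T\<close>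
    contains \<open>W\<close> and in particular 0.\<close>
  have "card P + 1 \<le> card B"
  proof -
    define T where "T = affine hull V"
    have T: "affine T" "affine hull (convex hull V) = T"
      by (simp_all add: T_def)
    have "V \<noteq> {}"
      using \<open>F \<noteq> {}\<close> by (auto simp: F_eq)
    then obtain y0 where y0: "y0 \<in> solutions P f"
      by (auto simp: V_def)
    define x0 where "x0 = Poly_Mapping.map real y0"
    have x0: "x0 \<in> T" "x0 \<in> W"
      using y0 V_W by (auto simp: T_def V_def x0_def intro: hull_inc)
    define L where "L = (\<lambda>x. - x0 + x) ` T"
    have subL: "subspace L"
      unfolding L_def using T x0 by (intro affine_diffs_subspace)
    have "e q \<in> L" if q: "q \<in> P" for q
    proof -
      obtain m :: nat where m: "m > 0" "(\<Sum>i<m. q) = 0"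
        using tors[OF q] by blast
      have sum_lookup: "(\<Sum>p\<in>Poly_Mapping.keys y. \<Sum>i<Poly_Mapping.lookup y p. p) =
          (\<Sum>p\<in>P. \<Sum>i<Poly_Mapping.lookup y p. p)" if "Poly_Mapping.keys y \<subseteq> P" for y :: "circle \<Rightarrow>\<^sub>0 nat"
        using that fin by (intro sum.mono_neutral_left) (auto simp: in_keys_iff)
      \<comment> \<open>Adding \<open>m\<close> copies of \<open>q\<close> does not change the sum
        of a solution, so \<open>m\<close> times \<open>e q\<close> is a direction of
        \<open>T\<close>.\<close>
      define y1 where "y1 = y0 + Poly_Mapping.single q m"
      have keys: "Poly_Mapping.keys y0 \<subseteq> P" "Poly_Mapping.keys y1 \<subseteq> P"
        using y0 q Poly_Mapping.keys_add[of y0 "Poly_Mapping.single q m"] by (auto simp: solutions_def y1_def split: if_splits)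
      have "(\<Sum>i<a + b. r) = (\<Sum>i<a. r) + (\<Sum>i<b. r)" for a b :: nat and r :: circle
        by (induction b) (simp_all add: algebra_simps)
      then have "(\<Sum>i<Poly_Mapping.lookup y1 r. r) = (\<Sum>i<Poly_Mapping.lookup y0 r. r)" for r
        using m by (auto simp: y1_def lookup_add lookup_single when_def)
      moreover have "y \<in> solutions P f \<longleftrightarrow> (\<Sum>p\<in>P. \<Sum>i<Poly_Mapping.lookup y p. p) = f"
        if "Poly_Mapping.keys y \<subseteq> P" for y
        using that sum_lookup[OF that] by (simp add: solutions_def)
      ultimately have "y1 \<in> solutions P f"
        using y0 keys by simp
      then have "Poly_Mapping.map real y1 \<in> T"
        unfolding T_def V_def by (auto intro: hull_inc)
      then have "- x0 + Poly_Mapping.map real y1 \<in> L"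
        by (auto simp: L_def)
      moreover have "- x0 + Poly_Mapping.map real y1 = real m *\<^sub>R e q"
        by (rule poly_mapping_eqI)
          (auto simp: x0_def y1_def e_def lookup_add lookup_minus lookup_scaleR lookup_single when_def lookup_real)
      ultimately have "(1 / real m) *\<^sub>R (real m *\<^sub>R e q) \<in> L"
        using subL by (metis subspace_scale)
      then show ?thesis
        using m by simp
    qed
    then have "W \<subseteq> L"
      unfolding W_def using subL by (intro span_minimal) auto
    then have "- x0 \<in> L"
      using x0 by (auto simp: W_def intro: span_neg)
    then have "0 \<in> T"
      by (auto simp: L_def)
    then have "0 \<in> affine hull B"
      using B T by simp
    \<comment> \<open>Writing 0 as an affine combination of \<open>B\<close> makes some
      \<open>b\<close> redundant in the linear span of \<open>B\<close>. This is the source of the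
      extra 1 in the bound.\<close>
    then obtain u where u: "sum u B = 1" "(\<Sum>v\<in>B. u v *\<^sub>R v) = 0"
      using B(1) by (auto simp: affine_hull_finite)
    then have "\<exists>b\<in>B. u b \<noteq> 0"
      by (metis sum.neutral zero_neq_one)
    then obtain b where b: "b \<in> B" "u b \<noteq> 0"
      by blast
    have "u b *\<^sub>R b = - (\<Sum>v\<in>B - {b}. u v *\<^sub>R v)"
      using u(2) sum.remove[OF B(1) b(1), of "\<lambda>v. u v *\<^sub>R v"] by (simp add: eq_neg_iff_add_eq_0)
    also have "\<dots> \<in> span (B - {b})"
      by (intro span_neg span_sum span_scale span_base)
    finally have "(1 / u b) *\<^sub>R (u b *\<^sub>R b) \<in> span (B - {b})"
      by (rule span_scale)
    then have "b \<in> span (B - {b})"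
      using b by simp
    then have "B \<subseteq> span (B - {b})"
      by (metis Diff_iff insertE insert_Diff_single span_base subsetI insert_iff)
    then have "span B \<subseteq> span (B - {b})"
      by (metis span_minimal subspace_span)
    moreover have "T \<subseteq> span B"
      using B T affine_hull_subset_span[of B] by simp
    moreover have "x \<in> T" if "x \<in> W" for x
    proof -
      have "x - x0 \<in> L"
        using that x0 \<open>W \<subseteq> L\<close> by (auto simp: W_def intro!: span_diff)
      then show ?thesis
        by (auto simp: L_def)
    qed
    moreover have "e ` P \<subseteq> W"
      by (auto simp: W_def intro: span_base)
    ultimately have "e ` P \<subseteq> span (B - {b})"
      by blast
    then have "card P \<le> card (B - {b})"
      using independent_span_bound[OF _ indep_e, of "B - {b}"] B(1) card_e by auto
    then show ?thesis
      using B(1) b(1) by (metis Suc_diff_1 Suc_eq_plus1 Suc_le_mono card_Diff_singleton card_gt_0_iff empty_iff)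
  qed
  then have card_C: "card P \<le> card C"
    using B C by linarith

  have C_sub: "C \<subseteq> affine hull F"
    using C(2) hull_subset[of C affine] by auto
  then have ev_C: "ev \<pi> c = 1" "ev \<theta> c = 1" if "c \<in> C" for c
    using aff_F that by auto
  \<comment> \<open>As \<open>ev \<pi>\<close> is 1 on \<open>C\<close>, the coefficients of a
    vanishing combination add up to 0, so affine independence gives linear independence.\<close>
  have indep_C: "independent C"
  proof (rule independent_if_scalars_zero)
    fix h c assume sum0: "(\<Sum>x\<in>C. h x *\<^sub>R x) = 0" and c: "c \<in> C"
    have "0 = ev \<pi> (\<Sum>x\<in>C. h x *\<^sub>R x)"
      using sum0 ev_linear[of \<pi>] by (simp add: linear_0)
    also have "\<dots> = sum h C"
      using ev_linear[of \<pi>] ev_C by (simp add: linear_sum linear_scale)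
    finally have "sum h C = 0" ..
    then show "h c = 0"
      using C(3) affine_dependent_explicit_finite[OF C(1)] sum0 c by blast
  qed (use C in simp)
  have "C \<subseteq> W"
  proof -
    have "affine hull F \<subseteq> W"
      using hull_W by (intro hull_minimal) (auto simp: F_eq W_def subspace_imp_affine)
    then show ?thesis
      using C_sub by blast
  qed
  have "e p \<in> span C"
  proof (rule ccontr)
    assume notin: "e p \<notin> span C"
    then have indep: "independent (insert (e p) C)" and "e p \<notin> C"
      using indep_C independent_insertI span_base by blast+
    have "insert (e p) C \<subseteq> span (e ` P)"
      using \<open>C \<subseteq> W\<close> p by (auto simp: W_def intro: span_base)
    then have "card (insert (e p) C) \<le> card (e ` P)"
      using independent_span_bound[OF _ indep, of "e ` P"] fin by simp
    then show False
      using \<open>e p \<notin> C\<close> C(1) card_C card_e by simp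
  qed
  moreover have "subspace {y. ev \<theta> y = ev \<pi> y}"
    using ev_linear[of \<theta>] ev_linear[of \<pi>]
    by (auto simp: subspace_def linear_add linear_scale linear_0)
  moreover have "C \<subseteq> {y. ev \<theta> y = ev \<pi> y}"
    using ev_C by auto
  ultimately have "e p \<in> {y. ev \<theta> y = ev \<pi> y}"
    using span_minimal by blast
  then have "ev \<theta> (e p) = ev \<pi> (e p)"
    by simp
  then show ?thesis
    using ev_e[OF p] by simp
qed

text \<open>In the rational vector space of the reals, the assignment of 1 to the independent vector
  1 extends linearly.\<close>

lemma real_rat_functional:
  obtains g :: "real \<Rightarrow> rat" where "\<And>x y. g (x + y) = g x + g y" "g 1 = 1"
proof -
  interpret Q: vector_space_pair "\<lambda>(q::rat) (x::real). of_rat q * x" "(*) :: rat \<Rightarrow> rat \<Rightarrow> rat"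
    by unfold_locales (auto simp: of_rat_add of_rat_mult algebra_simps)
  have "Q.vs1.independent {1}"
    by (simp add: Q.vs1.independent_insert)
  from Q.linear_independent_extend[OF this, of "\<lambda>_. 1"]
  obtain g where g: "Vector_Spaces.linear (\<lambda>(q::rat) (x::real). of_rat q * x) (*) g" "g 1 = 1"
    by auto
  then interpret g: Vector_Spaces.linear "\<lambda>(q::rat) (x::real). of_rat q * x" "(*)" g
    by simp
  show thesis
    using that[of g] g.add g(2) by blast
qed

text \<open>A \<open>\<rat>\<close>-linear functional \<open>\<real> \<rightarrow> \<rat>\<close> fixing 1 preserves the equations given by the tight solutions,
  whose coefficients are integers; by uniqueness it fixes the values of \<open>\<pi>\<close>.\<close>

lemma facet_function_rational:
  assumes "finite P" and "\<And>p. p \<in> P \<Longrightarrow> \<exists>m>0::nat. (\<Sum>i<m. p) = (0::circle)"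
    and "facet_function P f \<pi>" and "p \<in> P"
  shows "\<pi> p \<in> \<rat>"
proof -
  obtain g :: "real \<Rightarrow> rat" where add: "\<And>x y. g (x + y) = g x + g y" and one: "g 1 = 1"
    using real_rat_functional by blast
  have zero: "g 0 = 0"
    using add[of 0 0] by simp
  have sum: "g (sum h A) = (\<Sum>x\<in>A. g (h x))" for h :: "circle \<Rightarrow> real" and A
    by (induction A rule: infinite_finite_induct) (simp_all add: add zero)
  have mult: "g (x * real n) = g x * of_nat n" for x n
    by (induction n) (simp_all add: add zero algebra_simps)
  have "real_of_rat (g (\<pi> p)) = \<pi> p"
  proof (rule facet_function_unique[OF assms(1,2,3) _ assms(4), where \<theta> = "\<lambda>p. real_of_rat (g (\<pi> p))"])
    fix y assume "(\<Sum>p\<in>Poly_Mapping.keys y. \<pi> p * real (Poly_Mapping.lookup y p)) = 1"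
    then have "real_of_rat (g (\<Sum>p\<in>Poly_Mapping.keys y. \<pi> p * real (Poly_Mapping.lookup y p))) = 1"
      by (simp add: one)
    then show "(\<Sum>p\<in>Poly_Mapping.keys y. real_of_rat (g (\<pi> p)) * real (Poly_Mapping.lookup y p)) = 1"
      by (simp add: sum mult of_rat_sum of_rat_mult)
  qed
  then show ?thesis
    by (metis Rats_of_rat)
qed

text \<open>If \<open>p\<close> occurred in no tight solution, raising \<open>\<pi> p\<close> by 1
  would preserve all tight equations, against uniqueness.\<close>

lemma facet_function_tight:
  assumes "finite P" and "\<And>p. p \<in> P \<Longrightarrow> \<exists>m>0::nat. (\<Sum>i<m. p) = (0::circle)"
    and "facet_function P f \<pi>" and "p \<in> P"
  obtains y where "y \<in> solutions P f" "p \<in> Poly_Mapping.keys y"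
    "(\<Sum>p\<in>Poly_Mapping.keys y. \<pi> p * real (Poly_Mapping.lookup y p)) = 1"
proof (rule ccontr)
  assume none: "\<not> thesis"
  have "(\<pi>(p := \<pi> p + 1)) p = \<pi> p"
  proof (rule facet_function_unique[OF assms(1,2,3) _ assms(4), where \<theta> = "\<pi>(p := \<pi> p + 1)"])
    fix y assume y: "y \<in> solutions P f" "(\<Sum>p\<in>Poly_Mapping.keys y. \<pi> p * real (Poly_Mapping.lookup y p)) = 1"
    then have "p \<notin> Poly_Mapping.keys y"
      using none that by blast
    then have "(\<Sum>q\<in>Poly_Mapping.keys y. (\<pi>(p := \<pi> p + 1)) q * real (Poly_Mapping.lookup y q)) =
        (\<Sum>q\<in>Poly_Mapping.keys y. \<pi> q * real (Poly_Mapping.lookup y q))"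
      by (intro sum.cong) auto
    then show "(\<Sum>q\<in>Poly_Mapping.keys y. (\<pi>(p := \<pi> p + 1)) q * real (Poly_Mapping.lookup y q)) = 1"
      using y by simp
  qed
  then show False
    by simp
qed

section \<open>The circle group\<close>

lemma circle_of_eq_iff: "circle_of x = circle_of y \<longleftrightarrow> x - y \<in> \<int>"
  by (rule circle.abs_eq_iff)

lemma circle_of_add: "circle_of (x + y) = circle_of x + circle_of y"
  by (simp add: plus_circle.abs_eq)

lemma circle_of_minus: "circle_of (- x) = - circle_of x"
  by (simp add: uminus_circle.abs_eq)

lemma circle_of_diff: "circle_of (x - y) = circle_of x - circle_of y"
  by (simp add: minus_circle.abs_eq)

lemma circle_of_Ints: "x \<in> \<int> \<Longrightarrow> circle_of x = 0"
  by (simp add: zero_circle_def circle_of_eq_iff)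

lemma circle_of_rep: "circle_of (rep_circle x) = x"
  by (rule Quotient_abs_rep[OF Quotient_circle])

section \<open>Distance to the nearest integer and the induced norm on the circle\<close>

definition dist_int :: "real \<Rightarrow> real" where
  "dist_int t = \<bar>t - of_int (round t)\<bar>"

lemma dist_int_le: "dist_int t \<le> \<bar>t - of_int k\<bar>"
  unfolding dist_int_def by (rule round_diff_minimal)

lemma dist_int_nonneg: "0 \<le> dist_int t"
  by (simp add: dist_int_def)

lemma dist_int_le_half: "dist_int t \<le> 1 / 2"
  unfolding dist_int_def using of_int_round_abs_le[of t] by (simp add: abs_minus_commute)

lemma dist_int_Ints: "t \<in> \<int> \<Longrightarrow> dist_int t = 0"
  by (auto simp: dist_int_def elim: Ints_cases)

lemma dist_int_add: "dist_int (x + y) \<le> dist_int x + dist_int y"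
  using dist_int_le[of "x + y" "round x + round y"] by (simp add: dist_int_def)

lemma dist_int_minus: "dist_int (- x) = dist_int x"
proof (rule antisym)
  have le: "dist_int (- x) \<le> dist_int x" for x
    using dist_int_le[of "- x" "- round x"] by (simp add: dist_int_def abs_minus_commute add.commute)
  show "dist_int (- x) \<le> dist_int x" "dist_int x \<le> dist_int (- x)"
    using le[of x] le[of "- x"] by simp_all
qed

lemma dist_int_cong:
  assumes "x - y \<in> \<int>"
  shows "dist_int x = dist_int y"
proof -
  have "dist_int x \<le> dist_int y" if "x - y \<in> \<int>" for x y
    using dist_int_add[of y "x - y"] dist_int_Ints[OF that] by simp
  from this[OF assms] this[of y x] show ?thesis
    using Ints_minus[OF assms] by simp
qed

lemma dist_int_lipschitz: "\<bar>dist_int x - dist_int y\<bar> \<le> \<bar>x - y\<bar>"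
proof -
  have "dist_int x - dist_int y \<le> \<bar>x - y\<bar>" for x y
    using dist_int_le[of x "round y"] by (simp add: dist_int_def)
  from this[of x y] this[of y x] show ?thesis
    by simp
qed

text \<open>A shift by half a period reflects this triangle wave about its mean 1/4. This yields the
  oddness of \<open>\<zeta>\<close> later.\<close>

lemma dist_int_add_half: "dist_int (x + 1 / 2) = 1 / 2 - dist_int x"
proof (rule antisym)
  define r where "r = x - of_int (round x)"
  have "\<bar>r\<bar> \<le> 1 / 2" "dist_int x = \<bar>r\<bar>" and x: "x = of_int (round x) + r"
    using dist_int_le_half[of x] by (simp_all add: r_def dist_int_def)
  moreover have "dist_int (x + 1 / 2) \<le> \<bar>r + 1 / 2\<bar>" "dist_int (x + 1 / 2) \<le> \<bar>r - 1 / 2\<bar>"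
    using dist_int_le[of "x + 1 / 2" "round x"] dist_int_le[of "x + 1 / 2" "round x + 1"]
    by (simp_all add: r_def algebra_simps)
  ultimately show "dist_int (x + 1 / 2) \<le> 1 / 2 - dist_int x"
    by linarith
  have "dist_int (1 / 2) \<le> dist_int (x + 1 / 2) + dist_int (- x)"
    using dist_int_add[of "x + 1 / 2" "- x"] by simp
  moreover have "dist_int (1 / 2) = 1 / 2"
    by (simp add: dist_int_def round_def)
  ultimately show "1 / 2 - dist_int x \<le> dist_int (x + 1 / 2)"
    by (simp add: dist_int_minus)
qed

definition circle_norm :: "circle \<Rightarrow> real" where
  "circle_norm c = dist_int (rep_circle c)"

lemma rep_circle_of: "rep_circle (circle_of t) - t \<in> \<int>"
  using circle_of_rep[of "circle_of t"] by (simp add: circle_of_eq_iff)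

lemma circle_norm_circle_of: "circle_norm (circle_of t) = dist_int t"
  unfolding circle_norm_def by (rule dist_int_cong) (rule rep_circle_of)

lemma circle_norm_nonneg: "0 \<le> circle_norm c"
  by (simp add: circle_norm_def dist_int_nonneg)

lemma circle_norm_zero: "circle_norm 0 = 0"
  using circle_norm_circle_of[of 0] by (simp add: circle_of_Ints dist_int_Ints)

lemma circle_norm_add: "circle_norm (a + b) \<le> circle_norm a + circle_norm b"
  using dist_int_add[of "rep_circle a" "rep_circle b"]
    circle_norm_circle_of[of "rep_circle a + rep_circle b"]
  by (simp add: circle_of_add circle_of_rep circle_norm_def)

section \<open>Common denominators and torsion of rational points\<close>

lemma rational_common_denominator:
  assumes "finite X" "X \<subseteq> \<rat>"
  shows "\<exists>q::nat. q > 0 \<and> (\<forall>x\<in>X. real q * x \<in> \<int>)"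
  using assms
proof (induction X rule: finite_induct)
  case empty
  show ?case
    by (intro exI[of _ 1]) simp
next
  case (insert x X)
  then obtain q :: nat where q: "q > 0" "\<forall>x\<in>X. real q * x \<in> \<int>"
    by auto
  obtain a b :: int where ab: "b > 0" "x = of_int a / of_int b"
    using insert.prems by (auto elim: Rats_cases')
  have b: "real (nat b) = of_int b"
    using ab by simp
  have "real (q * nat b) * y \<in> \<int>" if "y \<in> insert x X" for y
  proof (cases "y = x")
    case True
    then have "real (q * nat b) * y = of_int (int q * a)"
      using ab by (simp add: b)
    then show ?thesis
      by (metis Ints_of_int)
  next
    case False
    have "real (q * nat b) * y = (real q * y) * of_int b"
      using ab by (simp add: b)
    moreover have "(real q * y) * of_int b \<in> \<int>"
      using q False that by (intro Ints_mult[of "real q * y"]) auto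
    ultimately show ?thesis
      by (simp only:)
  qed
  then show ?case
    using q ab by (intro exI[of _ "q * nat b"]) auto
qed

lemma rational_circle_torsion:
  assumes "p \<in> rational_circle"
  shows "\<exists>m>0::nat. (\<Sum>i<m. p) = 0"
proof -
  obtain x where x: "p = circle_of x" "x \<in> \<rat>"
    using assms by (auto simp: rational_circle_def)
  obtain m :: nat where m: "m > 0" "real m * x \<in> \<int>"
    using rational_common_denominator[of "{x}"] x by auto
  have "(\<Sum>i<k. circle_of x) = circle_of (real k * x)" for k
    by (induction k) (simp_all add: circle_of_Ints circle_of_add[symmetric] algebra_simps)
  then show ?thesis
    using m x circle_of_Ints by metis
qed

section \<open>Two-slope functions are extreme\<close>

text \<open>A local form of Cauchy's functional equation. Nonnegativity makes \<open>g\<close>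
  monotone, and squeezing \<open>x\<close> between consecutive multiples of
  \<open>\<delta> / n\<close> bounds the deviation from linearity by
  \<open>g \<delta> / n\<close>.\<close>

lemma additive_nonneg_imp_linear:
  fixes g :: "real \<Rightarrow> real"
  assumes \<delta>: "0 < \<delta>" and nonneg: "\<And>x. 0 \<le> x \<Longrightarrow> x \<le> \<delta> \<Longrightarrow> 0 \<le> g x"
    and add: "\<And>x y. 0 \<le> x \<Longrightarrow> 0 \<le> y \<Longrightarrow> x + y \<le> \<delta> \<Longrightarrow> g (x + y) = g x + g y"
    and x: "0 \<le> x" "x \<le> \<delta>"
  shows "g x = x / \<delta> * g \<delta>"
proof -
  have mono: "g y \<le> g z" if "0 \<le> y" "y \<le> z" "z \<le> \<delta>" for y z
    using add[of y "z - y"] nonneg[of "z - y"] that by simp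
  have close: "\<bar>g x - x / \<delta> * g \<delta>\<bar> \<le> g \<delta> / real n" if n: "n > 0" for n
  proof -
    define \<eta> where "\<eta> = \<delta> / real n"
    have \<eta>: "\<eta> > 0" "\<delta> = real n * \<eta>"
      using n \<delta> by (auto simp: \<eta>_def)
    have mult: "g (real k * \<eta>) = real k * g \<eta>" if "k \<le> n" for k
      using that
    proof (induction k)
      case 0
      then show ?case
        using add[of 0 0] \<delta> by simp
    next
      case (Suc k)
      have "real k * \<eta> + \<eta> = real (Suc k) * \<eta>"
        by (simp add: algebra_simps)
      moreover have "\<dots> \<le> \<delta>"
        using Suc.prems \<eta> by (simp only: \<eta>(2)) (intro mult_right_mono, auto)
      ultimately show ?case
        using Suc add[of "real k * \<eta>" \<eta>] \<eta> by (simp add: algebra_simps)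
    qed
    have g\<delta>: "g \<delta> = real n * g \<eta>"
      using mult[of n] \<eta> by simp
    have g\<eta>: "0 \<le> g \<eta>"
      using g\<delta> nonneg[of \<delta>] \<delta> n by (simp add: zero_le_mult_iff)
    \<comment> \<open>The right endpoint is separated so that the upper neighbour
      \<open>real (Suc k) * \<eta>\<close> stays within \<open>\<delta>\<close>.\<close>
    show ?thesis
    proof (cases "x = \<delta>")
      case True
      then show ?thesis
        using \<delta> nonneg[of \<delta>] by simp
    next
      case False
      define k where "k = nat \<lfloor>x / \<eta>\<rfloor>"
      have "real k = of_int \<lfloor>x / \<eta>\<rfloor>"
        using x \<eta> by (simp add: k_def)
      then have k': "real k \<le> x / \<eta>" "x / \<eta> < real k + 1"
        by linarith+
      then have k: "real k * \<eta> \<le> x" "x \<le> real (Suc k) * \<eta>"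
        using \<eta> by (simp_all add: field_simps)
      have "real k * \<eta> < real n * \<eta>"
        using k(1) x False \<eta>(2) by simp
      then have "k < n"
        using \<eta>(1) by simp
      then have "real (Suc k) * \<eta> \<le> \<delta>"
        unfolding \<eta>(2) using \<eta>(1) by (intro mult_right_mono) auto
      then have "g (real k * \<eta>) \<le> g x" "g x \<le> g (real (Suc k) * \<eta>)"
        using k x \<eta> by (auto intro!: mono)
      then have "real k * g \<eta> \<le> g x" "g x \<le> real (Suc k) * g \<eta>"
        using mult[of k] mult[of "Suc k"] \<open>k < n\<close> by simp_all
      moreover have "x / \<delta> * g \<delta> = x / \<eta> * g \<eta>"
        unfolding g\<delta> unfolding \<eta>(2) using n by simp
      moreover note mult_right_mono[OF k'(1) g\<eta>] mult_right_mono[OF less_imp_le[OF k'(2)] g\<eta>]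
      ultimately have "\<bar>g x - x / \<delta> * g \<delta>\<bar> \<le> g \<eta>"
        by (simp add: algebra_simps abs_le_iff)
      then show ?thesis
        using g\<delta> n by simp
    qed
  qed
  have "(\<lambda>n. g \<delta> / real n) \<longlonglongrightarrow> 0"
    by (rule lim_const_over_n)
  then have "\<bar>g x - x / \<delta> * g \<delta>\<bar> \<le> 0"
    using close by (intro tendsto_lowerbound[of _ _ sequentially])
      (auto intro!: eventually_sequentiallyI[of 1])
  then show ?thesis
    by simp
qed

text \<open>Neighbouring cells may have the same slope, so grid points need not be true breakpoints.
  Equal cell lengths let slopes be compared by counting cells.\<close>

locale two_slope_grid =
  fixes \<phi> :: "circle \<Rightarrow> real" and N :: nat and S :: real
  assumes N_pos: "0 < N" and S_pos: "0 < S"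
    and nonneg: "0 \<le> \<phi> x" and zero: "\<phi> 0 = 0"
    and cell: "\<exists>\<sigma>\<in>{S, - S}. \<forall>t\<in>{0..1 / N}.
      \<phi> (circle_of (of_int k / N + t)) = \<phi> (circle_of (of_int k / N)) + \<sigma> * t"
begin

lemma cellE:
  obtains \<sigma> where "\<sigma> \<in> {S, - S}" "\<And>t. t \<in> {0..1 / N} \<Longrightarrow>
    \<phi> (circle_of (of_int k / N + t)) = \<phi> (circle_of (of_int k / N)) + \<sigma> * t"
  using cell[of k] by blast

text \<open>A nonnegative function vanishing at 0 cannot descend to the right of 0, which selects
  the slope \<open>S\<close>. The left side is the mirror image.\<close>

lemma at_right_zero: "0 \<le> t \<Longrightarrow> t \<le> 1 / N \<Longrightarrow> \<phi> (circle_of t) = S * t"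
proof -
  assume t: "0 \<le> t" "t \<le> 1 / N"
  obtain \<sigma> where \<sigma>: "\<sigma> \<in> {S, - S}" "\<And>t. t \<in> {0..1 / N} \<Longrightarrow> \<phi> (circle_of t) = \<sigma> * t"
    using cellE[of 0] zero by (simp add: circle_of_Ints) metis
  have "0 \<le> \<sigma> * (1 / N)"
    using \<sigma>(2)[of "1 / N"] nonneg[of "circle_of (1 / N)"] by simp
  then have "\<sigma> = S"
    using \<sigma>(1) N_pos S_pos by (auto simp: field_simps)
  then show ?thesis
    using \<sigma>(2) t by simp
qed

lemma at_left_zero: "0 \<le> t \<Longrightarrow> t \<le> 1 / N \<Longrightarrow> \<phi> (circle_of (- t)) = S * t"
proof -
  assume t: "0 \<le> t" "t \<le> 1 / N"
  obtain \<sigma> where \<sigma>: "\<sigma> \<in> {S, - S}"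
    "\<And>t. t \<in> {0..1 / N} \<Longrightarrow> \<phi> (circle_of (- 1 / N + t)) = \<phi> (circle_of (- 1 / N)) + \<sigma> * t"
    using cellE[of "- 1"] by (metis of_int_minus of_int_1)
  have eq: "\<phi> (circle_of (- 1 / N)) = - \<sigma> * (1 / N)"
    using \<sigma>(2)[of "1 / N"] zero by (simp add: circle_of_Ints)
  then have "0 \<le> - \<sigma> * (1 / N)"
    using nonneg[of "circle_of (- 1 / N)"] by simp
  then have "\<sigma> = - S"
    using \<sigma>(1) N_pos S_pos by (auto simp: field_simps)
  then show ?thesis
    using \<sigma>(2)[of "1 / N - t"] eq t by (simp add: algebra_simps)
qed

lemma grid_decomposition:
  obtains k :: int and t where "x = of_int k / N + t" "0 \<le> t" "t < 1 / N"
proof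
  show "x = of_int \<lfloor>x * N\<rfloor> / N + frac (x * N) / N"
    using N_pos by (simp add: frac_def field_simps)
  show "0 \<le> frac (x * N) / N" "frac (x * N) / N < 1 / N"
    using N_pos frac_lt_1[of "x * N"] by (auto simp: divide_strict_right_mono)
qed

text \<open>The additivities of \<open>\<phi>\<close> pass to both summands. They make
  \<open>\<pi>1\<close> linear on both sides of 0 and then, by translation, on every cell;
  periodicity and the value at \<open>f\<close> fix the remaining parameters.\<close>

lemma extreme_function:
  assumes min: "minimal_valid_function UNIV f \<phi>" and f: "\<phi> f = 1"
  shows "extreme_function UNIV f \<phi>"
proof -
  have eq: "\<pi>1 x = \<phi> x"
    if min1: "minimal_valid_function UNIV f \<pi>1" and min2: "minimal_valid_function UNIV f \<pi>2"
      and mean: "\<And>x. \<phi> x = (\<pi>1 x + \<pi>2 x) / 2" for \<pi>1 \<pi>2 x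
  proof -
    define \<delta> where "\<delta> = 1 / real N"
    have \<delta>: "\<delta> > 0" "real N * \<delta> = 1"
      using N_pos by (simp_all add: \<delta>_def)
    have valid: "valid_function UNIV f \<pi>1" "valid_function UNIV f \<pi>2"
      using min1 min2 by (simp_all add: minimal_valid_function_def)
    note \<pi>1_nonneg = valid_functionD(1)[OF valid(1)]
    \<comment> \<open>Both summands are subadditive, so equality for their mean forces equality for
      each.\<close>
    have additive: "\<pi>1 (x + y) = \<pi>1 x + \<pi>1 y" if "\<phi> (x + y) = \<phi> x + \<phi> y" for x y
      using that mean[of x] mean[of y] mean[of "x + y"]
        minimal_imp_subadditive[OF min1, of x y] minimal_imp_subadditive[OF min2, of x y]
      by (simp add: field_simps)
    have \<pi>1_zero: "\<pi>1 0 = 0"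
      using mean[of 0] zero \<pi>1_nonneg[of 0] valid_functionD(1)[OF valid(2), of 0] by simp
    have \<pi>1_f: "\<pi>1 f = 1"
      using mean[of f] f valid_functionD(2)[OF valid(1), of "{#f#}"]
        valid_functionD(2)[OF valid(2), of "{#f#}"] by simp
    define a where "a = \<pi>1 (circle_of \<delta>)"
    define b where "b = \<pi>1 (circle_of (- \<delta>))"
    have right: "\<pi>1 (circle_of t) = t / \<delta> * a" if "0 \<le> t" "t \<le> \<delta>" for t
      unfolding a_def
    proof (rule additive_nonneg_imp_linear[where g = "\<lambda>t. \<pi>1 (circle_of t)"])
      fix y z :: real assume "0 \<le> y" "0 \<le> z" "y + z \<le> \<delta>"
      then show "\<pi>1 (circle_of (y + z)) = \<pi>1 (circle_of y) + \<pi>1 (circle_of z)"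
        unfolding circle_of_add
        by (intro additive) (simp add: at_right_zero \<delta>_def ring_distribs flip: circle_of_add)
    qed (use \<delta> that \<pi>1_nonneg in auto)
    have left: "\<pi>1 (circle_of (- t)) = t / \<delta> * b" if "0 \<le> t" "t \<le> \<delta>" for t
      unfolding b_def
    proof (rule additive_nonneg_imp_linear[where g = "\<lambda>t. \<pi>1 (circle_of (- t))"])
      fix y z :: real assume yz: "0 \<le> y" "0 \<le> z" "y + z \<le> \<delta>"
      have "\<phi> (circle_of (- y) + circle_of (- z)) = \<phi> (circle_of (- (y + z)))"
        by (simp flip: circle_of_add)
      also have "\<dots> = \<phi> (circle_of (- y)) + \<phi> (circle_of (- z))"
        using yz at_left_zero[of y] at_left_zero[of z] at_left_zero[of "y + z"]
        by (simp add: \<delta>_def ring_distribs)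
      finally have "\<pi>1 (circle_of (- y) + circle_of (- z)) = \<pi>1 (circle_of (- y)) + \<pi>1 (circle_of (- z))"
        by (rule additive)
      then show "\<pi>1 (circle_of (- (y + z))) = \<pi>1 (circle_of (- y)) + \<pi>1 (circle_of (- z))"
        by (simp flip: circle_of_add)
    qed (use \<delta> that \<pi>1_nonneg in auto)
    \<comment> \<open>One formula for both slopes: the added bracket equals
      \<open>t / \<delta> * a\<close> on an increasing cell and \<open>- (t / \<delta> * b)\<close>
      on a decreasing one.\<close>
    have cell1: "\<pi>1 (circle_of (of_int k * \<delta> + t)) = \<pi>1 (circle_of (of_int k * \<delta>)) +
        ((a + b) / 2 / (S * \<delta>) * (\<phi> (circle_of (of_int k * \<delta> + t)) - \<phi> (circle_of (of_int k * \<delta>))) +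
         t / \<delta> * ((a - b) / 2))"
      if t: "0 \<le> t" "t \<le> \<delta>" for k :: int and t
    proof -
      obtain \<sigma> where \<sigma>: "\<sigma> \<in> {S, - S}"
        "\<And>t. t \<in> {0..\<delta>} \<Longrightarrow> \<phi> (circle_of (of_int k * \<delta> + t)) = \<phi> (circle_of (of_int k * \<delta>)) + \<sigma> * t"
        using cellE[of k] unfolding \<delta>_def times_divide_eq_right mult_1_right by blast
      consider "\<sigma> = S" | "\<sigma> = - S"
        using \<sigma>(1) by blast
      then show ?thesis
      proof cases
        case 1
        have "\<phi> (circle_of (of_int k * \<delta>) + circle_of t) = \<phi> (circle_of (of_int k * \<delta>)) + \<phi> (circle_of t)"
          using \<sigma>(2)[of t] t at_right_zero[of t] 1 by (simp add: \<delta>_def circle_of_add)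
        from additive[OF this]
        have "\<pi>1 (circle_of (of_int k * \<delta> + t)) = \<pi>1 (circle_of (of_int k * \<delta>)) + t / \<delta> * a"
          using right t by (simp add: circle_of_add)
        then show ?thesis
          using \<sigma>(2)[of t] t 1 S_pos \<delta> by (simp add: field_simps)
      next
        case 2
        \<comment> \<open>On a decreasing cell additivity holds for steps leftwards from the right
          endpoint, so the cell is traversed backwards.\<close>
        have down: "\<pi>1 (circle_of (of_int k * \<delta> + s)) = \<pi>1 (circle_of (of_int k * \<delta> + \<delta>)) + (\<delta> - s) / \<delta> * b"
          if s: "0 \<le> s" "s \<le> \<delta>" for s
        proof -
          have eq: "circle_of (of_int k * \<delta> + s) = circle_of (of_int k * \<delta> + \<delta>) + circle_of (- (\<delta> - s))"
            by (simp flip: circle_of_add)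
          have "\<phi> (circle_of (of_int k * \<delta> + \<delta>) + circle_of (- (\<delta> - s))) =
              \<phi> (circle_of (of_int k * \<delta> + \<delta>)) + \<phi> (circle_of (- (\<delta> - s)))"
            using \<sigma>(2)[of s] \<sigma>(2)[of \<delta>] s \<delta> at_left_zero[of "\<delta> - s"] 2
            by (simp add: \<delta>_def algebra_simps flip: circle_of_add)
          from additive[OF this] show ?thesis
            unfolding eq using left[of "\<delta> - s"] s by simp
        qed
        have "\<pi>1 (circle_of (of_int k * \<delta> + t)) = \<pi>1 (circle_of (of_int k * \<delta>)) - t / \<delta> * b"
          using down[OF t] down[of 0] \<delta> by (simp add: field_simps)
        moreover have "\<phi> (circle_of (of_int k * \<delta> + t)) - \<phi> (circle_of (of_int k * \<delta>)) = - (S * t)"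
          using \<sigma>(2)[of t] t 2 by simp
        moreover have "(a + b) / 2 / (S * \<delta>) * - (S * t) + t / \<delta> * ((a - b) / 2) = - (t / \<delta> * b)"
          using S_pos \<delta>(1) by (simp add: field_simps)
        ultimately show ?thesis
          by simp
      qed
    qed
    \<comment> \<open>An increasing cell of \<open>\<phi>\<close> changes \<open>\<pi>1\<close> by \<open>a\<close> and a decreasing one by \<open>-b\<close>, so \<open>\<pi>1\<close> is \<open>c \<phi>\<close> plus the
      drift \<open>e\<close> per cell, which vanishes by periodicity.\<close>
    define c e where "c = (a + b) / 2 / (S * \<delta>)" and "e = (a - b) / 2"
    note cell1 = cell1[folded c_def e_def]
    have grid: "\<pi>1 (circle_of (real k * \<delta>)) = c * \<phi> (circle_of (real k * \<delta>)) + real k * e" for k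
    proof (induction k)
      case 0
      then show ?case
        using zero \<pi>1_zero by (simp add: circle_of_Ints)
    next
      case (Suc k)
      have eq: "real (Suc k) * \<delta> = of_int (int k) * \<delta> + \<delta>"
        by (simp add: algebra_simps)
      show ?case
        unfolding eq using cell1[of \<delta> "int k"] Suc \<delta> by (simp add: algebra_simps)
    qed
    have e: "e = 0"
      using grid[of N] \<delta> N_pos zero \<pi>1_zero by (simp add: circle_of_Ints)
    have proportional: "\<pi>1 x = c * \<phi> x" for x
    proof -
      \<comment> \<open>The grid formula covers natural indices, hence the representative in
        \<open>[0, 1)\<close>.\<close>
      define r where "r = frac (rep_circle x)"
      have x: "x = circle_of r"
        using circle_of_rep[of x]
        by (metis circle_of_eq_iff Ints_of_int frac_def r_def diff_diff_eq2 add_diff_cancel_left' diff_add_cancel)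
      obtain k t where kt: "r = of_int k / N + t" "0 \<le> t" "t < 1 / N"
        by (rule grid_decomposition)
      have "of_int k / N > - 1 / real N"
        using kt frac_ge_0[of "rep_circle x"] by (simp add: r_def)
      then have "of_int k > (- 1 :: real)"
        using N_pos by (simp add: field_simps)
      then have "k \<ge> 0"
        by linarith
      then have k: "real_of_int k = real (nat k)"
        by simp
      show ?thesis
        using cell1[of t k] kt grid[of "nat k"] e unfolding x kt(1) k
        by (simp add: \<delta>_def algebra_simps)
    qed
    show ?thesis
      using proportional[of f] proportional[of x] f \<pi>1_f by simp
  qed
  show ?thesis
    unfolding extreme_function_def
  proof (intro conjI allI impI ballI min)
    fix \<pi>1 \<pi>2 p
    assume a: "minimal_valid_function UNIV f \<pi>1 \<and> minimal_valid_function UNIV f \<pi>2 \<and>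
      (\<forall>p\<in>UNIV. \<phi> p = (\<pi>1 p + \<pi>2 p) / 2)"
    then show "\<phi> p = \<pi>1 p"
      using eq[of \<pi>1 \<pi>2 p] by simp
    moreover have "\<phi> p = (\<pi>1 p + \<pi>2 p) / 2"
      using a by blast
    ultimately show "\<phi> p = \<pi>2 p"
      by simp
  qed
qed

text \<open>A derivative equals the right-hand one, and a cell extends to the right of every point;
  so only \<open>S\<close> and \<open>- S\<close> can occur. The two cells next to 0 realize
  both.\<close>

lemma two_slope: "two_slope \<phi>"
proof -
  have deriv: "s \<in> {S, - S}" if "((\<lambda>t. \<phi> (circle_of t)) has_real_derivative s) (at x)" for s x
  proof -
    obtain k t where kt: "x = of_int k / N + t" "0 \<le> t" "t < 1 / N"
      by (rule grid_decomposition)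
    obtain \<sigma> where \<sigma>: "\<sigma> \<in> {S, - S}"
      "\<And>t. t \<in> {0..1 / N} \<Longrightarrow> \<phi> (circle_of (of_int k / N + t)) = \<phi> (circle_of (of_int k / N)) + \<sigma> * t"
      by (metis cellE[of k])
    have "((\<lambda>h. (\<phi> (circle_of (x + h)) - \<phi> (circle_of x)) / h) \<longlongrightarrow> s) (at_right 0)"
      using that unfolding DERIV_def by (rule tendsto_within_subset) simp
    moreover have "((\<lambda>h. (\<phi> (circle_of (x + h)) - \<phi> (circle_of x)) / h) \<longlongrightarrow> \<sigma>) (at_right 0)"
    proof (rule tendsto_eventually)
      have "\<forall>\<^sub>F h in at_right 0. h < 1 / N - t"
        using kt by (intro eventually_at_right_less order_tendstoD(2)[OF tendsto_ident_at]) auto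
      moreover have "\<forall>\<^sub>F h in at_right (0::real). 0 < h"
        by (rule eventually_at_right_less)
      ultimately show "\<forall>\<^sub>F h in at_right 0. (\<phi> (circle_of (x + h)) - \<phi> (circle_of x)) / h = \<sigma>"
      proof eventually_elim
        case (elim h)
        then show ?case
          using \<sigma>(2)[of t] \<sigma>(2)[of "t + h"] kt by (simp add: add.assoc algebra_simps)
      qed
    qed
    ultimately have "s = \<sigma>"
      by (rule tendsto_unique[rotated]) simp
    then show ?thesis
      using \<sigma>(1) by simp
  qed
  have "((\<lambda>t. \<phi> (circle_of t)) has_real_derivative S) (at (1 / (2 * N)))"
  proof (rule has_field_derivative_transform_within_open)
    show "((\<lambda>t. S * t) has_real_derivative S) (at (1 / (2 * N)))"
      by (auto intro!: derivative_eq_intros)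
    show "S * t = \<phi> (circle_of t)" if "t \<in> {0<..<1 / N}" for t
      using at_right_zero[of t] that by simp
  qed (use N_pos in \<open>auto simp: field_simps\<close>)
  moreover have "((\<lambda>t. \<phi> (circle_of t)) has_real_derivative - S) (at (- (1 / (2 * N))))"
  proof (rule has_field_derivative_transform_within_open)
    show "((\<lambda>t. - S * t) has_real_derivative - S) (at (- (1 / (2 * N))))"
      by (auto intro!: derivative_eq_intros)
    show "- S * t = \<phi> (circle_of t)" if "t \<in> {- (1 / N)<..<0}" for t
      using at_left_zero[of "- t"] that by simp
  qed (use N_pos in \<open>auto simp: field_simps\<close>)
  ultimately have "{s. \<exists>x. ((\<lambda>t. \<phi> (circle_of t)) has_real_derivative s) (at x)} = {S, - S}"
    using deriv by blast
  then show ?thesis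
    using S_pos by (simp add: two_slope_def)
qed

text \<open>\<open>B\<close> consists of all grid points; an open interval avoiding them lies in a
  single cell.\<close>

lemma piecewise_linear:
  "\<exists>B. B \<subseteq> rational_circle \<and> piecewise_linear_breakpoints B \<phi>"
proof (intro exI conjI)
  define B where "B = (\<lambda>k::nat. circle_of (k / N)) ` {..<N}"
  show "B \<subseteq> rational_circle"
    by (auto simp: B_def rational_circle_def)
  have grid_in: "circle_of (of_int k / N) \<in> B" for k
  proof -
    have "of_int k = real_of_int (k div N) * N + of_int (k mod N)"
      by (metis div_mult_mod_eq of_int_add of_int_mult of_int_of_nat_eq)
    then have "of_int k / N - of_int (k mod N) / N = real_of_int (k div N)"
      using N_pos by (simp add: field_simps)
    then have eq: "circle_of (of_int k / N) = circle_of (nat (k mod N) / N)"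
      using N_pos by (simp add: circle_of_eq_iff)
    have mem: "nat (k mod N) \<in> {..<N}"
      using N_pos by (simp add: nat_less_iff)
    show ?thesis
      unfolding B_def eq by (rule imageI[OF mem])
  qed
  show "piecewise_linear_breakpoints B \<phi>"
    unfolding piecewise_linear_breakpoints_def
  proof (intro conjI allI impI)
    show "finite B"
      by (simp add: B_def)
    fix a b :: real
    assume ab: "a < b \<and> (\<forall>x\<in>{a<..<b}. circle_of x \<notin> B)"
    obtain k t where kt: "a = of_int k / N + t" "0 \<le> t" "t < 1 / N"
      by (rule grid_decomposition)
    have b: "b \<le> of_int k / N + 1 / N"
    proof (rule ccontr)
      assume "\<not> ?thesis"
      then have "of_int (k + 1) / N \<in> {a<..<b}"
        using kt by (simp add: add_divide_distrib)
      then show False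
        using ab grid_in[of "k + 1"] by blast
    qed
    obtain \<sigma> where \<sigma>:
      "\<And>t. t \<in> {0..1 / N} \<Longrightarrow> \<phi> (circle_of (of_int k / N + t)) = \<phi> (circle_of (of_int k / N)) + \<sigma> * t"
      by (metis cellE[of k])
    show "\<exists>m c. \<forall>x\<in>{a<..<b}. \<phi> (circle_of x) = m * x + c"
    proof (intro exI ballI)
      fix x assume "x \<in> {a<..<b}"
      then show "\<phi> (circle_of x) = \<sigma> * x + (\<phi> (circle_of (of_int k / N)) - \<sigma> * (of_int k / N))"
        using \<sigma>[of "x - of_int k / N"] kt b by (simp add: algebra_simps)
    qed
  qed
qed

end

section \<open>Functions with slopes of constant modulus on a grid\<close>

text \<open>On every cell \<open>[k/N, (k+1)/N]\<close> such a function is affine with slope \<open>\<plusminus>S\<close>: the parity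
  condition makes it change by exactly \<open>S/N\<close>. Unlike the latter property, this one
  is closed under \<open>max\<close> and \<open>min\<close>.\<close>

definition parity_lipschitz :: "nat \<Rightarrow> real \<Rightarrow> (real \<Rightarrow> real) \<Rightarrow> bool" where
  "parity_lipschitz N S \<psi> \<longleftrightarrow> (\<forall>x y. \<bar>\<psi> x - \<psi> y\<bar> \<le> S * \<bar>x - y\<bar>) \<and>
     (\<forall>k::int. \<exists>m::int. \<psi> (of_int k / N) = S / N * of_int m \<and> even (m - k))"

lemma parity_lipschitz_max:
  assumes "parity_lipschitz N S \<psi>" "parity_lipschitz N S \<theta>"
  shows "parity_lipschitz N S (\<lambda>t. max (\<psi> t) (\<theta> t))"
proof -
  have "\<bar>max (\<psi> x) (\<theta> x) - max (\<psi> y) (\<theta> y)\<bar> \<le> S * \<bar>x - y\<bar>" for x y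
  proof -
    have "\<bar>\<psi> x - \<psi> y\<bar> \<le> S * \<bar>x - y\<bar>" "\<bar>\<theta> x - \<theta> y\<bar> \<le> S * \<bar>x - y\<bar>"
      using assms by (auto simp: parity_lipschitz_def)
    then show ?thesis
      by linarith
  qed
  then show ?thesis
    using assms by (auto simp: parity_lipschitz_def max_def)
qed

text \<open>Since \<open>s\<close> has even grid index \<open>2 * j\<close>, the index
  \<open>k\<close> goes to \<open>2 * j - k\<close>, of the same parity; negating the value
  preserves parity too.\<close>

lemma parity_lipschitz_reflect:
  assumes "parity_lipschitz N S \<psi>" and s: "real N * s = 2 * of_int j" and "N > 0"
  shows "parity_lipschitz N S (\<lambda>t. - \<psi> (s - t))"
  unfolding parity_lipschitz_def
proof (intro conjI allI)
  show "\<bar>- \<psi> (s - x) - - \<psi> (s - y)\<bar> \<le> S * \<bar>x - y\<bar>" for x y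
  proof -
    have "\<bar>\<psi> (s - y) - \<psi> (s - x)\<bar> \<le> S * \<bar>(s - y) - (s - x)\<bar>"
      using assms unfolding parity_lipschitz_def by blast
    then show ?thesis
      by simp
  qed
  fix k :: int
  obtain m :: int where m: "\<psi> (of_int (2 * j - k) / N) = S / N * of_int m" "even (m - (2 * j - k))"
    using assms unfolding parity_lipschitz_def by blast
  have "of_int (2 * j - k) / N = s - of_int k / N"
    using s \<open>N > 0\<close> by (simp add: field_simps)
  then show "\<exists>m::int. - \<psi> (s - of_int k / N) = S / N * of_int m \<and> even (m - k)"
    using m by (intro exI[of _ "- m"]) auto
qed

lemma parity_lipschitz_min:
  assumes "parity_lipschitz N S \<psi>" "parity_lipschitz N S \<theta>"
  shows "parity_lipschitz N S (\<lambda>t. min (\<psi> t) (\<theta> t))"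
proof -
  have "\<bar>min (\<psi> x) (\<theta> x) - min (\<psi> y) (\<theta> y)\<bar> \<le> S * \<bar>x - y\<bar>" for x y
  proof -
    have "\<bar>\<psi> x - \<psi> y\<bar> \<le> S * \<bar>x - y\<bar>" "\<bar>\<theta> x - \<theta> y\<bar> \<le> S * \<bar>x - y\<bar>"
      using assms by (auto simp: parity_lipschitz_def)
    then show ?thesis
      by linarith
  qed
  then show ?thesis
    using assms by (auto simp: parity_lipschitz_def min_def)
qed

lemma parity_lipschitz_Min:
  assumes "finite I" "I \<noteq> {}" and "\<And>i. i \<in> I \<Longrightarrow> parity_lipschitz N S (\<psi> i)"
  shows "parity_lipschitz N S (\<lambda>t. Min ((\<lambda>i. \<psi> i t) ` I))"
  using assms
proof (induction I rule: finite_ne_induct)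
  case (insert i I)
  then have "parity_lipschitz N S (\<lambda>t. min (\<psi> i t) (Min ((\<lambda>i. \<psi> i t) ` I)))"
    by (intro parity_lipschitz_min) auto
  then show ?case
    using insert.hyps by simp
qed simp

lemma parity_lipschitz_add_const:
  assumes "parity_lipschitz N S \<psi>" and c: "c = 2 * (S / N) * of_int j"
  shows "parity_lipschitz N S (\<lambda>t. c + \<psi> t)"
  unfolding parity_lipschitz_def
proof (intro conjI allI)
  show "\<bar>c + \<psi> x - (c + \<psi> y)\<bar> \<le> S * \<bar>x - y\<bar>" for x y
    using assms by (simp add: parity_lipschitz_def)
  fix k :: int
  obtain m :: int where "\<psi> (of_int k / N) = S / N * of_int m" "even (m - k)"
    using assms unfolding parity_lipschitz_def by blast
  then show "\<exists>m::int. c + \<psi> (of_int k / N) = S / N * of_int m \<and> even (m - k)"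
    using c by (intro exI[of _ "2 * j + m"]) (simp add: algebra_simps)
qed

text \<open>The index of \<open>a\<close> is even, and so is \<open>N\<close>, the index shift
  caused by a translation by 1; neither affects parity.\<close>

lemma parity_lipschitz_dist_int:
  assumes "N > 0" "even N" "S \<ge> 0" and a: "real N * a = 2 * of_int j"
  shows "parity_lipschitz N S (\<lambda>t. S * dist_int (t - a))"
  unfolding parity_lipschitz_def
proof (intro conjI allI)
  show "\<bar>S * dist_int (x - a) - S * dist_int (y - a)\<bar> \<le> S * \<bar>x - y\<bar>" for x y
    using mult_left_mono[OF dist_int_lipschitz[of "x - a" "y - a"] \<open>S \<ge> 0\<close>] \<open>S \<ge> 0\<close>
    by (simp add: abs_mult flip: right_diff_distrib)
  fix k :: int
  define r where "r = round (of_int k / N - a)"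
  have "S * dist_int (of_int k / N - a) = S / N * (real N * \<bar>of_int k / N - a - of_int r\<bar>)"
    using \<open>N > 0\<close> by (simp add: dist_int_def r_def)
  also have "real N * \<bar>of_int k / N - a - of_int r\<bar> = \<bar>real N * (of_int k / N - a - of_int r)\<bar>"
    by (simp add: abs_mult)
  also have "real N * (of_int k / N - a - of_int r) = of_int (k - 2 * j - int N * r)"
    using a \<open>N > 0\<close> by (simp add: field_simps)
  finally have "S * dist_int (of_int k / N - a) = S / N * of_int \<bar>k - 2 * j - int N * r\<bar>"
    by simp
  moreover have "even (\<bar>k - 2 * j - int N * r\<bar> - k)"
    using \<open>even N\<close> by (auto simp: abs_if)
  ultimately show "\<exists>m::int. S * dist_int (of_int k / N - a) = S / N * of_int m \<and> even (m - k)"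
    by blast
qed

text \<open>Four grid cells make up one period \<open>1 / Q\<close>. The phase 1/4 places a rising
  zero at the origin, so that even indices are zeros or extrema at even height as parity
  demands.\<close>

lemma parity_lipschitz_wave:
  assumes "Q > 0" "S \<ge> 0"
  shows "parity_lipschitz (4 * Q) S (\<lambda>t. S / Q * (dist_int (Q * t + 1 / 4) - 1 / 4))"
  unfolding parity_lipschitz_def
proof (intro conjI allI)
  fix x y :: real
  have "\<bar>S / Q * (dist_int (Q * x + 1 / 4) - 1 / 4) - S / Q * (dist_int (Q * y + 1 / 4) - 1 / 4)\<bar>
      = S / Q * \<bar>dist_int (Q * x + 1 / 4) - dist_int (Q * y + 1 / 4)\<bar>"
    using assms by (simp add: abs_mult flip: right_diff_distrib diff_divide_distrib)
  also have "\<dots> \<le> S / Q * \<bar>(Q * x + 1 / 4) - (Q * y + 1 / 4)\<bar>"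
    using assms by (intro mult_left_mono dist_int_lipschitz) auto
  also have "\<dots> = S * \<bar>x - y\<bar>"
    using assms by (simp add: abs_mult flip: right_diff_distrib)
  finally show "\<bar>S / Q * (dist_int (Q * x + 1 / 4) - 1 / 4) - S / Q * (dist_int (Q * y + 1 / 4) - 1 / 4)\<bar>
      \<le> S * \<bar>x - y\<bar>" .
next
  fix k :: int
  define r where "r = round (of_int (k + 1) / 4 :: real)"
  have "real Q * (of_int k / real (4 * Q)) + 1 / 4 = of_int (k + 1) / 4"
    using assms by (simp add: field_simps)
  then have "dist_int (real Q * (of_int k / real (4 * Q)) + 1 / 4) = \<bar>of_int (k + 1) / 4 - of_int r\<bar>"
    by (simp only: dist_int_def r_def)
  also have "\<dots> = of_int \<bar>k + 1 - 4 * r\<bar> / 4"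
    by (simp add: field_simps)
  finally have "S / Q * (dist_int (real Q * (of_int k / real (4 * Q)) + 1 / 4) - 1 / 4) =
      S / real (4 * Q) * of_int (\<bar>k + 1 - 4 * r\<bar> - 1)"
    using assms by (simp add: field_simps)
  moreover have "even (\<bar>k + 1 - 4 * r\<bar> - 1 - k)"
    by (auto simp: abs_if)
  ultimately show "\<exists>m::int. S / Q * (dist_int (real Q * (of_int k / real (4 * Q)) + 1 / 4) - 1 / 4) =
      S / real (4 * Q) * of_int m \<and> even (m - k)"
    by blast
qed

text \<open>The change over the cell exhausts the Lipschitz bound, so the bounds from the two
  endpoints meet at every interior point.\<close>

lemma parity_lipschitz_cell:
  assumes "parity_lipschitz N S \<psi>" and "N > 0" "S > 0"
  shows "\<exists>\<sigma>\<in>{S, - S}. \<forall>t\<in>{0..1 / N}. \<psi> (of_int k / N + t) = \<psi> (of_int k / N) + \<sigma> * t"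
proof -
  define h where "h = S / N"
  have "h > 0"
    using assms by (simp add: h_def)
  have lip: "\<bar>\<psi> x - \<psi> y\<bar> \<le> S * \<bar>x - y\<bar>" for x y
    using assms unfolding parity_lipschitz_def by blast
  obtain m where m: "\<psi> (of_int k / N) = h * of_int m" "even (m - k)"
    using assms unfolding parity_lipschitz_def h_def by blast
  obtain m' where m': "\<psi> (of_int (k + 1) / N) = h * of_int m'" "even (m' - (k + 1))"
    using assms unfolding parity_lipschitz_def h_def by blast
  have next_point: "of_int (k + 1) / N = of_int k / N + 1 / real N"
    by (simp add: add_divide_distrib)
  have diff: "of_int (k + 1) / N - of_int k / N = 1 / real N"
    unfolding next_point by simp
  have "\<bar>h * of_int m' - h * of_int m\<bar> \<le> S * \<bar>1 / real N\<bar>"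
    using lip[of "of_int (k + 1) / N" "of_int k / N"] unfolding m(1) m'(1) diff .
  then have "\<bar>h * of_int m' - h * of_int m\<bar> \<le> h"
    by (simp add: h_def)
  then have "h * \<bar>of_int (m' - m)\<bar> \<le> h * 1"
    using \<open>h > 0\<close> by (simp add: abs_mult flip: right_diff_distrib)
  then have "\<bar>m' - m\<bar> \<le> 1"
    using \<open>h > 0\<close> by (simp flip: of_int_abs)
  moreover have "odd (m' - m)"
    using m(2) m'(2) by presburger
  ultimately have "m' = m + 1 \<or> m' = m - 1"
    by presburger
  moreover have m'_next: "\<psi> (of_int k / N + 1 / N) = h * of_int m'"
    using m'(1) unfolding next_point .
  moreover have bounds:
    "\<bar>\<psi> (of_int k / N + t) - \<psi> (of_int k / N)\<bar> \<le> S * t"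
    "\<bar>\<psi> (of_int k / N + 1 / N) - \<psi> (of_int k / N + t)\<bar> \<le> S * (1 / N - t)" if "t \<in> {0..1 / N}" for t
    using lip[of "of_int k / N + t" "of_int k / N"] that
      lip[of "of_int k / N + 1 / N" "of_int k / N + t"] by simp_all
  ultimately show ?thesis
  proof (elim disjE)
    assume "m' = m + 1"
    then have "\<psi> (of_int k / N + 1 / N) = \<psi> (of_int k / N) + S / N"
      unfolding m'_next m(1) by (simp add: h_def ring_distribs)
    then have "\<psi> (of_int k / N + t) = \<psi> (of_int k / N) + S * t" if "t \<in> {0..1 / N}" for t
      using bounds[OF that] by (simp add: right_diff_distrib abs_le_iff)
    then show ?thesis
      by blast
  next
    assume "m' = m - 1"
    then have "\<psi> (of_int k / N + 1 / N) = \<psi> (of_int k / N) - S / N"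
      unfolding m'_next m(1) by (simp add: h_def ring_distribs)
    then have "\<psi> (of_int k / N + t) = \<psi> (of_int k / N) + - S * t" if "t \<in> {0..1 / N}" for t
      using bounds[OF that] by (simp add: right_diff_distrib abs_le_iff)
    then show ?thesis
      by blast
  qed
qed

section \<open>The two-slope extension\<close>

text \<open>Since \<open>1 - A (f - x) \<le> A x\<close>, the expression is a median, and replacing
  \<open>x\<close> by \<open>f - x\<close> turns it into its complement to 1. Each point has value
  \<open>A\<close> or at least \<open>1 / 2 + \<zeta>\<close>, and of three points two always fall
  into the same class.\<close>

lemma clamp_subadditive_symmetric:
  fixes A \<zeta> :: "'a::ab_group_add \<Rightarrow> real"
  assumes A_nonneg: "\<And>x. 0 \<le> A x" and A_subadd: "\<And>x y. A (x + y) \<le> A x + A y"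
    and A_zero: "A 0 = 0" and A_f: "A f = 1"
    and \<zeta>_lipschitz: "\<And>x t. \<bar>\<zeta> (x + t) - \<zeta> x\<bar> \<le> A t"
    and \<zeta>_odd: "\<And>x. \<zeta> (f - x) = - \<zeta> x"
    and \<zeta>_small: "\<And>x. - (1 / 6) \<le> \<zeta> x"
  defines "\<phi> \<equiv> \<lambda>x. max (1 - A (f - x)) (min (1 / 2 + \<zeta> x) (A x))"
  shows "0 \<le> \<phi> x" "\<phi> 0 = 0" "\<phi> x + \<phi> (f - x) = 1" "\<phi> (x + y) \<le> \<phi> x + \<phi> y"
proof -
  have A_symm: "1 \<le> A x + A (f - x)" for x
    using A_subadd[of x "f - x"] A_f by simp
  have symm: "\<phi> x + \<phi> (f - x) = 1" for x
    using A_symm[of x] \<zeta>_odd[of x] by (auto simp: \<phi>_def max_def min_def)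
  show "\<phi> x + \<phi> (f - x) = 1" by (fact symm)
  show "0 \<le> \<phi> x"
    using A_nonneg[of x] \<zeta>_small[of x] by (auto simp: \<phi>_def max_def min_def)
  show "\<phi> 0 = 0"
    using A_zero A_f \<zeta>_small[of 0] by (auto simp: \<phi>_def max_def min_def)
  have split: "\<phi> x = A x \<or> 1 / 2 + \<zeta> x \<le> \<phi> x" for x
    using A_symm[of x] by (auto simp: \<phi>_def max_def min_def)
  have lower: "1 - A (f - x) \<le> \<phi> x" for x
    by (simp add: \<phi>_def)
  have two: "1 \<le> \<phi> x + \<phi> y + \<phi> t"
    if "x + y + t = f" and "1 / 2 + \<zeta> x \<le> \<phi> x" and "1 / 2 + \<zeta> y \<le> \<phi> y" and "\<phi> t = A t" for x y t
  proof -
    have "y = f - (x + t)"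
      using that(1) by (auto simp: algebra_simps)
    then have "\<zeta> y = - \<zeta> (x + t)"
      by (simp only: \<zeta>_odd)
    then show ?thesis
      using \<zeta>_lipschitz[of x t] that by simp
  qed
  have one: "1 \<le> \<phi> x + \<phi> y + \<phi> t"
    if "x + y + t = f" and "\<phi> x = A x" and "\<phi> y = A y" for x y t
  proof -
    have "f - t = x + y"
      using that(1) by (auto simp: algebra_simps)
    then show ?thesis
      using lower[of t] A_subadd[of x y] that by simp
  qed
  have triple: "1 \<le> \<phi> x + \<phi> y + \<phi> t" if eq: "x + y + t = f" for x y t
  proof -
    have eqs: "x + t + y = f" "y + t + x = f" "y + x + t = f"
      using eq by (auto simp: algebra_simps)
    consider "\<phi> x = A x" "\<phi> y = A y" | "\<phi> x = A x" "\<phi> t = A t" | "\<phi> y = A y" "\<phi> t = A t"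
      | "\<phi> x = A x" "1 / 2 + \<zeta> y \<le> \<phi> y" "1 / 2 + \<zeta> t \<le> \<phi> t"
      | "\<phi> y = A y" "1 / 2 + \<zeta> x \<le> \<phi> x" "1 / 2 + \<zeta> t \<le> \<phi> t"
      | "\<phi> t = A t" "1 / 2 + \<zeta> x \<le> \<phi> x" "1 / 2 + \<zeta> y \<le> \<phi> y"
      | "1 / 2 + \<zeta> x \<le> \<phi> x" "1 / 2 + \<zeta> y \<le> \<phi> y" "1 / 2 + \<zeta> t \<le> \<phi> t"
      using split[of x] split[of y] split[of t] by blast
    then show ?thesis
    proof cases
      \<comment> \<open>The constant 1/6 is chosen for this case: each of the three values is at
        least 1/2 - 1/6 = 1/3.\<close>
      case 7
      then show ?thesis
        using \<zeta>_small[of x] \<zeta>_small[of y] \<zeta>_small[of t] by simp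
    qed (use one[OF eq] one[OF eqs(1)] one[OF eqs(2)] two[OF eq] two[OF eqs(1)] two[OF eqs(2)]
      in simp_all)
  qed
  show "\<phi> (x + y) \<le> \<phi> x + \<phi> y"
    using triple[of x y "f - (x + y)"] symm[of "x + y"] by simp
qed

text \<open>The common denominator \<open>D\<close> allows the values of \<open>\<rho>\<close> to be
  placed on the vertical grid of step \<open>S / N\<close>.\<close>

lemma two_slope_extension:
  fixes \<rho> :: "circle \<Rightarrow> real" and r :: "circle \<Rightarrow> nat"
  assumes G: "subgroup_circle G" "finite G" "G \<subseteq> rational_circle" and f: "f \<in> G"
    and D: "D > 0" "\<And>a. \<rho> a = real (r a) / real D"
    and \<rho>_zero: "\<rho> 0 = 0" and \<rho>_f: "\<rho> f = 1"
    and \<rho>_subadd: "\<And>a b. a \<in> G \<Longrightarrow> b \<in> G \<Longrightarrow> \<rho> (a + b) \<le> \<rho> a + \<rho> b"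
  shows "\<exists>\<phi>. extreme_function UNIV f \<phi> \<and> (\<forall>g\<in>G. \<rho> g + \<rho> (f - g) = 1 \<longrightarrow> \<phi> g = \<rho> g) \<and>
    continuous_circle \<phi> \<and> two_slope \<phi> \<and> (\<exists>B. B \<subseteq> rational_circle \<and> piecewise_linear_breakpoints B \<phi>)"
proof -
  have G_zero: "0 \<in> G"
    using G by (simp add: subgroup_circle_def)
  have G_diff: "a - b \<in> G" if "a \<in> G" "b \<in> G" for a b
    using G that by (auto simp: subgroup_circle_def)
  have G_add: "a + b \<in> G" if "a \<in> G" "b \<in> G" for a b
    using G_diff[OF that(1) G_diff[OF G_zero that(2)]] by simp
  have rep_rat: "rep_circle a \<in> \<rat>" if "a \<in> G" for a
  proof -
    obtain x where x: "a = circle_of x" "x \<in> \<rat>"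
      using G(3) \<open>a \<in> G\<close> unfolding rational_circle_def by blast
    have "(rep_circle (circle_of x) - x) + x \<in> \<rat>"
      using rep_circle_of[of x] x by (intro Rats_add) (auto elim: Ints_cases)
    then show ?thesis
      using x by simp
  qed
  obtain q :: nat where q: "q > 0" "\<And>a. a \<in> G \<Longrightarrow> real q * rep_circle a \<in> \<int>"
    using rational_common_denominator[of "rep_circle ` G"] G rep_rat by blast

  \<comment> \<open>\<open>R \<ge> \<rho> g\<close> and distinct points of \<open>G\<close> are at least \<open>1/q\<close> apart, so slope \<open>S = R q\<close> gives \<open>A = \<rho>\<close> on \<open>G\<close>.
    On the grid \<open>(1/N)\<int>\<close>, the elements of \<open>G\<close> have even index and \<open>1/2\<close> and the values of \<open>\<rho>\<close> are even
    multiples of \<open>S/N\<close>; this makes all pieces of \<open>\<phi>\<close> fall into the same parity class.\<close>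
  define R where "R = (\<Sum>a\<in>G. r a) + 1"
  define S where "S = R * q"
  define Q where "Q = 2 * S * D * q"
  define N where "N = 4 * Q"
  have pos: "R > 0" "S > 0" "Q > 0" "N > 0"
    using q D by (simp_all add: R_def S_def Q_def N_def)
  have S_bound: "\<rho> g \<le> S * circle_norm g" if g: "g \<in> G" for g
  proof (cases "circle_norm g = 0")
    case True
    then have "rep_circle g = of_int (round (rep_circle g))"
      by (simp add: circle_norm_def dist_int_def)
    then have "circle_of (rep_circle g) = 0"
      by (metis circle_of_Ints Ints_of_int)
    then show ?thesis
      using True \<rho>_zero by (simp add: circle_of_rep)
  next
    case False
    define m where "m = round (rep_circle g)"
    obtain j :: int where j: "real q * rep_circle g = of_int j"
      using q(2)[OF g] by (auto elim: Ints_cases)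
    have "q * circle_norm g = \<bar>real q * (rep_circle g - of_int m)\<bar>"
      by (simp add: circle_norm_def dist_int_def m_def abs_mult)
    also have "\<dots> = of_int \<bar>j - int q * m\<bar>"
      using j by (simp add: right_diff_distrib)
    finally have eq: "q * circle_norm g = of_int \<bar>j - int q * m\<bar>" .
    then have "\<bar>j - int q * m\<bar> \<noteq> 0"
      using False q(1) by auto
    then have "1 \<le> \<bar>j - int q * m\<bar>"
      by linarith
    then have "1 \<le> q * circle_norm g"
      unfolding eq by linarith
    then have "real R * 1 \<le> real R * (q * circle_norm g)"
      by (intro mult_left_mono) auto
    moreover have "r g \<le> R"
      unfolding R_def using G g by (intro trans_le_add1 member_le_sum) auto
    moreover have "\<rho> g \<le> r g"
      using D by (simp add: divide_le_eq mult_le_cancel_left1)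
    ultimately show ?thesis
      by (simp add: S_def mult.assoc)
  qed

  define A where "A x = Min ((\<lambda>a. \<rho> a + S * circle_norm (x - a)) ` G)" for x
  have A_le: "A x \<le> \<rho> a + S * circle_norm (x - a)" if "a \<in> G" for x a
    unfolding A_def using G that by (intro Min_le) auto
  have A_attained: "\<exists>a\<in>G. A x = \<rho> a + S * circle_norm (x - a)" for x
  proof -
    have "A x \<in> (\<lambda>a. \<rho> a + S * circle_norm (x - a)) ` G"
      unfolding A_def using G(2) f by (intro Min_in) auto
    then show ?thesis
      by blast
  qed
  have A_nonneg: "0 \<le> A x" for x
    using A_attained[of x] D by (auto simp: circle_norm_nonneg)
  have A_subadd: "A (x + y) \<le> A x + A y" for x y
  proof -
    obtain a b where a: "a \<in> G" "A x = \<rho> a + S * circle_norm (x - a)"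
      and b: "b \<in> G" "A y = \<rho> b + S * circle_norm (y - b)"
      using A_attained[of x] A_attained[of y] by auto
    have "A (x + y) \<le> \<rho> (a + b) + S * circle_norm ((x - a) + (y - b))"
      using A_le[OF G_add[OF a(1) b(1)], of "x + y"] by (simp add: algebra_simps)
    also have "\<dots> \<le> (\<rho> a + \<rho> b) + S * (circle_norm (x - a) + circle_norm (y - b))"
      using a b by (intro add_mono \<rho>_subadd mult_left_mono circle_norm_add) auto
    finally show ?thesis
      using a b by (simp add: algebra_simps)
  qed
  \<comment> \<open>For a competing centre \<open>a\<close>, subadditivity gives
    \<open>\<rho> g \<le> \<rho> a + \<rho> (g - a)\<close>, and \<open>S_bound\<close> controls the
    last term.\<close>
  have A_G: "A g = \<rho> g" if g: "g \<in> G" for g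
  proof (rule antisym)
    show "A g \<le> \<rho> g"
      using A_le[OF g, of g] by (simp add: circle_norm_zero)
    obtain a where a: "a \<in> G" "A g = \<rho> a + S * circle_norm (g - a)"
      using A_attained by blast
    then show "\<rho> g \<le> A g"
      using \<rho>_subadd[of a "g - a"] S_bound[of "g - a"] g G_diff by fastforce
  qed

  define z where "z t = S / Q * (dist_int (Q * t + 1 / 4) - 1 / 4)" for t :: real
  define \<zeta> where "\<zeta> c = z (rep_circle c)" for c
  have z_parity: "parity_lipschitz N S z"
    using parity_lipschitz_wave[of Q S] pos unfolding z_def N_def by simp
  have z_periodic: "z s = z t" if "real Q * (s - t) \<in> \<int>" for s t
    unfolding z_def using that by (intro arg_cong2[of _ _ _ _ "(*)"] arg_cong2[of _ _ _ _ "(-)"] dist_int_cong)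
      (simp_all add: algebra_simps)
  have \<zeta>_circle_of: "\<zeta> (circle_of t) = z t" for t
    unfolding \<zeta>_def by (intro z_periodic Ints_mult rep_circle_of) simp
  have z_odd: "z (- t) = - z t" for t
  proof -
    have "dist_int (Q * (- t) + 1 / 4) = dist_int (- (Q * (- t) + 1 / 4))"
      by (simp only: dist_int_minus)
    also have "\<dots> = dist_int ((Q * t + 1 / 4) + 1 / 2)"
      by (rule dist_int_cong) simp
    also have "\<dots> = 1 / 2 - dist_int (Q * t + 1 / 4)"
      by (rule dist_int_add_half)
    finally show ?thesis
      unfolding z_def by (simp only:) (simp add: algebra_simps)
  qed
  have Q_G: "real Q * rep_circle a \<in> \<int>" if "a \<in> G" for a
  proof -
    have "real Q * rep_circle a = of_nat (2 * S * D) * (real q * rep_circle a)"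
      by (simp add: Q_def)
    also have "\<dots> \<in> \<int>"
      using q(2)[OF that] by (rule Ints_mult[OF Ints_of_nat])
    finally show ?thesis .
  qed
  have \<zeta>_G: "\<zeta> (c + a) = \<zeta> c" if "a \<in> G" for c a
  proof -
    have "\<zeta> (circle_of (rep_circle c + rep_circle a)) = \<zeta> (circle_of (rep_circle c))"
      unfolding \<zeta>_circle_of by (rule z_periodic) (simp add: Q_G that)
    then show ?thesis
      by (simp add: circle_of_add circle_of_rep)
  qed
  have \<zeta>_odd: "\<zeta> (f - x) = - \<zeta> x" for x
  proof -
    have "\<zeta> (f - x) = \<zeta> (circle_of (- rep_circle x))"
      using \<zeta>_G[OF f, of "- x"] by (simp add: circle_of_minus circle_of_rep)
    then show ?thesis
      using \<zeta>_circle_of[of "rep_circle x"] by (simp add: \<zeta>_circle_of z_odd circle_of_rep)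
  qed
  \<comment> \<open>The amplitude is \<open>S / (4 * Q)\<close>, at most 1/8 because
    \<open>2 * S \<le> Q\<close>.\<close>
  have \<zeta>_small: "- (1 / 6) \<le> \<zeta> x" for x
  proof -
    have "1 \<le> D * q"
      using D q by simp
    then have "S * 1 \<le> S * (D * q)"
      by (rule mult_le_mono2)
    then have "2 * S \<le> Q"
      by (simp add: Q_def)
    then have "real S / real Q \<le> 1 / 2"
      using pos by (simp add: divide_le_eq)
    then have "real S / real Q * (1 / 4) \<le> 1 / 6"
      by simp
    moreover have "S / Q * (- (1 / 4)) \<le> \<zeta> x"
      unfolding \<zeta>_def z_def using pos dist_int_nonneg by (intro mult_left_mono) auto
    ultimately show ?thesis
      by simp
  qed
  \<comment> \<open>Modulo the period \<open>a\<close>, the shift by \<open>t\<close> is a real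
    shift by \<open>u\<close>, whose length is the distance from \<open>t\<close> to
    \<open>a\<close>.\<close>
  have \<zeta>_lipschitz: "\<bar>\<zeta> (x + t) - \<zeta> x\<bar> \<le> A t" for x t
  proof -
    obtain a where a: "a \<in> G" "A t = \<rho> a + S * circle_norm (t - a)"
      using A_attained by blast
    define s where "s = rep_circle (t - a)"
    define u where "u = s - of_int (round s)"
    have "circle_of u = t - a"
      by (simp add: u_def circle_of_diff circle_of_Ints s_def circle_of_rep)
    then have "x + t = circle_of (rep_circle x + u) + a"
      by (simp add: circle_of_add circle_of_rep)
    then have "\<zeta> (x + t) = z (rep_circle x + u)"
      using a by (simp add: \<zeta>_G \<zeta>_circle_of)
    moreover have "\<bar>z (rep_circle x + u) - z (rep_circle x)\<bar> \<le> S * \<bar>rep_circle x + u - rep_circle x\<bar>"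
      using z_parity unfolding parity_lipschitz_def by blast
    moreover have "\<bar>u\<bar> = circle_norm (t - a)"
      by (simp add: u_def s_def circle_norm_def dist_int_def)
    ultimately show ?thesis
      using a D by (simp add: \<zeta>_def add_increasing)
  qed

  define \<phi> where "\<phi> c = max (1 - A (f - c)) (min (1 / 2 + \<zeta> c) (A c))" for c
  have "A 0 = 0" "A f = 1"
    using A_G[OF f] A_G[of 0] G_zero \<rho>_zero \<rho>_f by simp_all
  note clamp = clamp_subadditive_symmetric[where A = A and \<zeta> = \<zeta> and f = f,
      OF A_nonneg A_subadd this \<zeta>_lipschitz \<zeta>_odd \<zeta>_small, folded \<phi>_def]
  have min: "minimal_valid_function UNIV f \<phi>"
    using clamp by (intro minimal_valid_functionI)

  define A' where "A' t = Min ((\<lambda>a. \<rho> a + S * dist_int (t - rep_circle a)) ` G)" for t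
  have A_circle_of: "A (circle_of t) = A' t" for t
  proof -
    have "circle_norm (circle_of t - a) = dist_int (t - rep_circle a)" for a
      using circle_norm_circle_of[of "t - rep_circle a"] by (simp add: circle_of_diff circle_of_rep)
    then show ?thesis
      by (simp add: A_def A'_def)
  qed
  have NG: "\<exists>j. real N * rep_circle a = 2 * of_int j" if a: "a \<in> G" for a
  proof -
    obtain i where i: "real Q * rep_circle a = of_int i"
      using Q_G[OF a] by (auto elim: Ints_cases)
    then have "real N * rep_circle a = 2 * of_int (2 * i)"
      by (simp add: N_def)
    then show ?thesis ..
  qed
  have A'_parity: "parity_lipschitz N S A'"
    unfolding A'_def
  proof (rule parity_lipschitz_Min)
    fix a assume a: "a \<in> G"
    obtain j where "real N * rep_circle a = 2 * of_int j"
      using NG[OF a] by blast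
    then have "parity_lipschitz N S (\<lambda>t. S * dist_int (t - rep_circle a))"
      using pos by (intro parity_lipschitz_dist_int) (auto simp: N_def)
    \<comment> \<open>Here \<open>S / N\<close> equals \<open>1 / (8 * D * q)\<close>, which
      determines the integer factor; the same holds for 1 and 1/2 below.\<close>
    moreover have "\<rho> a = 2 * (S / N) * of_int (4 * int q * int (r a))"
      using pos D q by (simp add: N_def Q_def field_simps)
    ultimately show "parity_lipschitz N S (\<lambda>t. \<rho> a + S * dist_int (t - rep_circle a))"
      by (rule parity_lipschitz_add_const)
  qed (use G f in auto)
  \<comment> \<open>The pullback of \<open>\<phi>\<close> to the real line; the form
    \<open>1 + - A'\<close> matches the closure rules for constants and reflections.\<close>
  define \<psi> where "\<psi> t = max (1 + - A' (rep_circle f - t)) (min (1 / 2 + z t) (A' t))" for t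
  have \<phi>_circle_of: "\<phi> (circle_of t) = \<psi> t" for t
  proof -
    have "f - circle_of t = circle_of (rep_circle f - t)"
      by (simp add: circle_of_diff circle_of_rep)
    then show ?thesis
      by (simp add: \<phi>_def \<psi>_def \<zeta>_circle_of A_circle_of)
  qed
  have \<psi>_parity: "parity_lipschitz N S \<psi>"
  proof -
    obtain j where j: "real N * rep_circle f = 2 * of_int j"
      using NG[OF f] by blast
    have "(1::real) = 2 * (S / N) * of_int (4 * int D * int q)"
      "(1 / 2::real) = 2 * (S / N) * of_int (2 * int D * int q)"
      using pos D q by (simp_all add: N_def Q_def field_simps)
    then show ?thesis
      unfolding \<psi>_def
      by (intro parity_lipschitz_max parity_lipschitz_min A'_parity z_parity
          parity_lipschitz_add_const parity_lipschitz_reflect[OF A'_parity j pos(4)])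
  qed

  interpret two_slope_grid \<phi> N S
  proof
    show "\<exists>\<sigma>\<in>{real S, - real S}. \<forall>t\<in>{0..1 / real N}.
        \<phi> (circle_of (of_int k / real N + t)) = \<phi> (circle_of (of_int k / real N)) + \<sigma> * t" for k
      unfolding \<phi>_circle_of using pos by (intro parity_lipschitz_cell \<psi>_parity) simp_all
  qed (use pos clamp in auto)
  have "\<phi> f = 1"
    using clamp(3)[of 0] clamp(2) by simp
  with min have "extreme_function UNIV f \<phi>"
    by (rule extreme_function)
  \<comment> \<open>For such \<open>g\<close> the outer two terms \<open>1 - A (f - g)\<close> and
    \<open>A g\<close> of the median coincide.\<close>
  moreover have "\<phi> g = \<rho> g" if "g \<in> G" "\<rho> g + \<rho> (f - g) = 1" for g
    using that f by (auto simp: \<phi>_def A_G G_diff)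
  moreover have "continuous_circle \<phi>"
  proof -
    have "S-lipschitz_on UNIV \<psi>"
      using \<psi>_parity by (intro lipschitz_onI) (auto simp: parity_lipschitz_def dist_real_def)
    then show ?thesis
      unfolding continuous_circle_def \<phi>_circle_of by (rule lipschitz_on_continuous_on)
  qed
  ultimately show ?thesis
    using two_slope piecewise_linear by blast
qed

section \<open>Extending a facet to a subadditive function on the finite group\<close>

lemma least_weight:
  fixes n :: "circle \<Rightarrow> nat"
  assumes valid: "\<And>M. set_mset M \<subseteq> G \<Longrightarrow> \<Sum>\<^sub># M = f \<Longrightarrow> D \<le> (\<Sum>x\<in>#M. n x)" and f: "f \<in> G"
  obtains r where "r 0 = 0" "D \<le> r f"
    "\<And>M. set_mset M \<subseteq> G \<Longrightarrow> r (\<Sum>\<^sub># M) \<le> (\<Sum>x\<in>#M. n x)"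
    "\<And>a b. a \<in> G \<Longrightarrow> b \<in> G \<Longrightarrow> r (a + b) \<le> r a + r b"
proof -
  \<comment> \<open>With natural weights the infimum over all representations is attained; joining
    optimal representations of \<open>a\<close> and \<open>b\<close> then gives
    subadditivity.\<close>
  define r where "r a = (LEAST k. \<exists>M. set_mset M \<subseteq> G \<and> \<Sum>\<^sub># M = a \<and> (\<Sum>x\<in>#M. n x) = k)" for a
  have le: "r (\<Sum>\<^sub># M) \<le> (\<Sum>x\<in>#M. n x)" if "set_mset M \<subseteq> G" for M
    unfolding r_def by (rule Least_le) (use that in blast)
  have attained: "\<exists>M. set_mset M \<subseteq> G \<and> \<Sum>\<^sub># M = a \<and> (\<Sum>x\<in>#M. n x) = r a" if "a \<in> G" for a
    unfolding r_def by (rule LeastI_ex) (use that in \<open>intro exI[of _ "{#a#}"] exI, auto\<close>)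
  have "r (a + b) \<le> r a + r b" if "a \<in> G" "b \<in> G" for a b
  proof -
    obtain K L where "set_mset K \<subseteq> G" "\<Sum>\<^sub># K = a" "(\<Sum>x\<in>#K. n x) = r a"
      "set_mset L \<subseteq> G" "\<Sum>\<^sub># L = b" "(\<Sum>x\<in>#L. n x) = r b"
      using attained \<open>a \<in> G\<close> \<open>b \<in> G\<close> by blast
    then show ?thesis
      using le[of "K + L"] by simp
  qed
  moreover have "r 0 = 0"
    using le[of "{#}"] by simp
  moreover have "D \<le> r f"
    using attained[OF f] valid by metis
  ultimately show thesis
    using that le by blast
qed

theorem theorem1p3:
  fixes G P :: "circle set" and f :: circle and \<pi> :: "circle \<Rightarrow> real"
  assumes "subgroup_circle G" and "finite G" and "G \<subseteq> rational_circle"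
    and "P \<subseteq> G" and "f \<in> G - {0}"
    and "facet_function P f \<pi>"
  shows "\<exists>\<phi>. extreme_function UNIV f \<phi> \<and> (\<forall>p\<in>P. \<phi> p = \<pi> p) \<and>
           continuous_circle \<phi> \<and> two_slope \<phi> \<and>
           (\<exists>B. B \<subseteq> rational_circle \<and> piecewise_linear_breakpoints B \<phi>)"
proof -
  have fin: "finite P" and f: "f \<in> G"
    using assms finite_subset by auto
  have tors: "\<exists>m>0::nat. (\<Sum>i<m. p) = 0" if "p \<in> P" for p
    using rational_circle_torsion assms(3,4) that by blast
  have valid: "valid_function P f \<pi>"
    using assms(6) by (simp add: facet_function_def)
  obtain D :: nat where D: "D > 0" "\<And>p. p \<in> P \<Longrightarrow> real D * \<pi> p \<in> \<int>"
    using rational_common_denominator[of "\<pi> ` P"] facet_function_rational[OF fin tors assms(6)] fin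
    by blast
  \<comment> \<open>Weights are scaled by \<open>D\<close> to become natural numbers. An element
    outside \<open>P\<close> costs \<open>D\<close>, so a solution using one meets the bound at
    once.\<close>
  define n where "n x = (if x \<in> P then nat \<lfloor>real D * \<pi> x\<rfloor> else D)" for x
  have n_P: "real (n p) = real D * \<pi> p" if "p \<in> P" for p
  proof -
    have "0 \<le> real D * \<pi> p"
      using valid that by (simp add: valid_function_def)
    moreover have "of_int \<lfloor>real D * \<pi> p\<rfloor> = real D * \<pi> p"
      using D(2)[OF that] by (auto elim: Ints_cases)
    ultimately show ?thesis
      using that by (simp add: n_def)
  qed
  have n_sum: "real (\<Sum>x\<in>#M. n x) = real D * (\<Sum>x\<in>#M. \<pi> x)" if "set_mset M \<subseteq> P" for M
    using that by (induction M) (simp_all add: n_P algebra_simps)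
  have "D \<le> (\<Sum>x\<in>#M. n x)" if M: "\<Sum>\<^sub># M = f" for M
  proof (cases "set_mset M \<subseteq> P")
    case True
    then have "1 \<le> (\<Sum>x\<in>#M. \<pi> x)"
      using valid M by (simp add: valid_function_iff_mset)
    then have "real D * 1 \<le> real (\<Sum>x\<in>#M. n x)"
      unfolding n_sum[OF True] by (intro mult_left_mono) auto
    then show ?thesis
      by (simp only: mult_1_right of_nat_le_iff)
  next
    case False
    then obtain x where x: "x \<in># M" "x \<notin> P"
      by auto
    then have "(\<Sum>x\<in>#M. n x) = n x + (\<Sum>x\<in>#M - {#x#}. n x)"
      by (metis insert_DiffM image_mset_add_mset sum_mset.add_mset)
    then show ?thesis
      using x by (simp add: n_def)
  qed
  then obtain r where r: "r 0 = 0" "D \<le> r f"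
    "\<And>M. set_mset M \<subseteq> G \<Longrightarrow> r (\<Sum>\<^sub># M) \<le> (\<Sum>x\<in>#M. n x)"
    "\<And>a b. a \<in> G \<Longrightarrow> b \<in> G \<Longrightarrow> r (a + b) \<le> r a + r b"
    using least_weight[where n = n and G = G and f = f and D = D] f by metis
  define \<rho> where "\<rho> a = real (r a) / real D" for a
  have \<rho>_zero: "\<rho> 0 = 0"
    by (simp add: \<rho>_def r)
  have \<rho>_f_ge: "1 \<le> \<rho> f"
    using r(2) D(1) by (simp add: \<rho>_def)
  have \<rho>_subadd: "\<rho> (a + b) \<le> \<rho> a + \<rho> b" if "a \<in> G" "b \<in> G" for a b
    using r(4)[OF that] D(1) by (simp add: \<rho>_def divide_right_mono flip: add_divide_distrib of_nat_add)
  \<comment> \<open>Removing \<open>p\<close> from a tight solution leaves a representation of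
    \<open>f - p\<close> of weight \<open>1 - \<pi> p\<close>. Together with
    \<open>\<rho> p \<le> \<pi> p\<close> and
    \<open>1 \<le> \<rho> f \<le> \<rho> p + \<rho> (f - p)\<close>, all bounds become
    equalities.\<close>
  have \<rho>_P: "\<rho> p = \<pi> p" and \<rho>_symm: "\<rho> (f - p) = 1 - \<pi> p" if p: "p \<in> P" for p
  proof -
    have le_sum: "\<rho> (\<Sum>\<^sub># M) \<le> (\<Sum>x\<in>#M. \<pi> x)" if "set_mset M \<subseteq> P" for M
    proof -
      have "r (\<Sum>\<^sub># M) \<le> (\<Sum>x\<in>#M. n x)"
        using that assms(4) by (intro r) auto
      then have "real (r (\<Sum>\<^sub># M)) \<le> real D * (\<Sum>x\<in>#M. \<pi> x)"
        unfolding n_sum[OF that, symmetric] by (rule of_nat_mono)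
      then show ?thesis
        using D(1) by (simp add: \<rho>_def field_simps)
    qed
    obtain y where y: "y \<in> solutions P f" "p \<in> Poly_Mapping.keys y"
      "(\<Sum>p\<in>Poly_Mapping.keys y. \<pi> p * real (Poly_Mapping.lookup y p)) = 1"
      by (rule facet_function_tight[OF fin tors assms(6) p])
    define M where "M = mset_of_pm y - {#p#}"
    have M: "mset_of_pm y = add_mset p M"
      using y(2) by (simp add: M_def set_mset_of_pm)
    have "set_mset M \<subseteq> P" "p + \<Sum>\<^sub># M = f"
      using y(1) unfolding solutions_iff_mset M by auto
    moreover have "\<pi> p + (\<Sum>x\<in>#M. \<pi> x) = 1"
      using y(3) unfolding sum_mset_of_pm[symmetric] M by simp
    ultimately have "\<rho> (f - p) \<le> 1 - \<pi> p"
      using le_sum[of M] by (auto simp: algebra_simps)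
    moreover have "\<rho> p \<le> \<pi> p"
      using le_sum[of "{#p#}"] p by simp
    moreover have "f - p \<in> G"
      using assms(1,4) f p by (auto simp: subgroup_circle_def)
    then have "\<rho> f \<le> \<rho> p + \<rho> (f - p)"
      using \<rho>_subadd[of p "f - p"] assms(4) p by auto
    ultimately show "\<rho> p = \<pi> p" "\<rho> (f - p) = 1 - \<pi> p"
      using \<rho>_f_ge by linarith+
  qed
  \<comment> \<open>For \<open>f\<close> in \<open>P\<close>, the symmetry at \<open>p = f\<close>
    reads \<open>\<rho> 0 = 1 - \<pi> f\<close>; otherwise the singleton \<open>{#f#}\<close> has
    weight \<open>D\<close>.\<close>
  have "\<rho> f = 1"
  proof (cases "f \<in> P")
    case True
    then show ?thesis
      using \<rho>_P[OF True] \<rho>_symm[OF True] \<rho>_zero by simp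
  next
    case False
    then have "r f \<le> D"
      using r(3)[of "{#f#}"] f by (simp add: n_def)
    then show ?thesis
      using \<rho>_f_ge D(1) by (simp add: \<rho>_def)
  qed
  from two_slope_extension[OF assms(1-3) f D(1) \<rho>_def \<rho>_zero this \<rho>_subadd]
  obtain \<phi> where "extreme_function UNIV f \<phi>" "\<forall>g\<in>G. \<rho> g + \<rho> (f - g) = 1 \<longrightarrow> \<phi> g = \<rho> g"
    "continuous_circle \<phi>" "two_slope \<phi>" "\<exists>B. B \<subseteq> rational_circle \<and> piecewise_linear_breakpoints B \<phi>"
    by auto
  moreover have "\<phi> p = \<pi> p" if "p \<in> P" for p
    using calculation(2) \<rho>_P[OF that] \<rho>_symm[OF that] assms(4) that by fastforce
  ultimately show ?thesis
    by blast
qed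

end
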